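(* Let $n\ge 3$ and let $G$ be the (localized Fourier transform of the) Gauss-Manin system of the Givental-Hori-Vafa model $f=u_1+\cdots+u_{n-2}+\frac{(u_{n-1}+q)^2}{u_1\cdots u_{n-1}}$ of a smooth quadric in $\mathbb{P}^n$, equipped with its connection $\nabla$. Then there is a direct sum decomposition $$G=H\oplus H^{\circ}$$ of free $\mathbb{C}[\theta,\theta^{-1},q,q^{-1}]$-modules, where $H$ is free of rank $n$ and is equipped with a connection (induced by $\nabla$) making it isomorphic to the differential system associated with the small quantum cohomology of quadrics in $\mathbb{P}^n$.
   Context: Let $V=(\mathbb{C}^* )^{n-1}$ with coordinates $u=(u_1,\dots,u_{n-1})$, let $q$ be a coordinate on another copy of $\mathbb{C}^*$, and let $\Omega^p(V)$ be the space of regular algebraic $p$-forms on $V$. Below $d$ and $df$ are taken with respect to $u$ only ($q$ is a parameter). The module $G$ is $$G=\frac{\Omega^{n-1}(V)[q,q^{-1},\theta,\theta^{-1}]}{(\theta d-df\wedge)\,\Omega^{n-2}(V)[q,q^{-1},\theta,\theta^{-1}]},$$ a $\mathbb{C}[\theta,\theta^{-1},q,q^{-1}]$-module; $[\,\cdot\,]$ denotes the class in $G$. It carries the flat connection $\nabla$ given by $$\theta^2\nabla_{\partial_\theta}\Big[\sum_i\omega_i\theta^i\Big]=\Big[\sum_i f\omega_i\theta^i\Big]+\Big[\sum_i i\,\omega_i\theta^{i+1}\Big],\qquad \theta\nabla_{q\partial_q}\Big[\sum_i\omega_i\theta^i\Big]=\Big[\sum_i q\partial_q(\omega_i)\theta^{i+1}\Big]-\Big[\sum_i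 q\tfrac{\partial f}{\partial q}\omega_i\theta^i\Big],$$ where $\omega_i\in\Omega^{n-1}(V)[q,q^{-1}]$ and $q\partial_q(\omega_i)$ is the Lie derivative in the direction $q\partial_q$. The differential system associated with the small quantum cohomology (ambient part) of a quadric in $\mathbb{P}^n$: the ambient part has basis $b_0=1,b_1=b,\dots,b_{n-1}$, where $b$ is the hyperplane class and $b_i$ the $i$-fold cup-product of $b$, and quantum multiplication by $b$ is $$b\circ b_i=b_{i+1}\ (0\le i\le n-3),\qquad b\circ b_{n-2}=b_{n-1}+2q\,b_0,\qquad b\circ b_{n-1}=2q\,b_1 .$$ The system is the free $\mathbb{C}[\theta,\theta^{-1},q,q^{-1}]$-module with basis $b_0,\dots,b_{n-1}$ and the connection for which $$\theta\nabla_{q\partial_q}b_i=-\,b\circ b_i,\qquad \theta^2\nabla_{\partial_\theta}b_i=(n-1)\,b\circ b_i+i\,\theta\,b_i\qquad (0\le i\le n-1).$$ *)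

theory Defs
  imports Complex_Main "HOL-Library.Poly_Mapping" "HOL-Algebra.Module" "HOL-Algebra.AbelCoset"
begin

section \<open>Laurent polynomials\<close>

text \<open>Laurent polynomials are elements of the group ring of the free abelian group of exponent
  vectors: a finitely supported map from exponent vectors (finitely supported maps from variables
  to integers) to complex coefficients.\<close>

datatype var = U nat | Q | Theta

type_synonym laurent = "(var \<Rightarrow>\<^sub>0 int) \<Rightarrow>\<^sub>0 complex"

definition xpow :: "var \<Rightarrow> int \<Rightarrow> laurent" where
  "xpow v k = Poly_Mapping.single (Poly_Mapping.single v k) 1"

definition pdiff :: "var \<Rightarrow> laurent \<Rightarrow> laurent" where
  "pdiff v p = (\<Sum>e\<in>Poly_Mapping.keys p.
     Poly_Mapping.single (e - Poly_Mapping.single v 1)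
       (of_int (Poly_Mapping.lookup e v) * Poly_Mapping.lookup p e))"

definition laurent_ring :: "var set \<Rightarrow> laurent ring" where
  "laurent_ring S = \<lparr>carrier = {p. \<forall>e\<in>Poly_Mapping.keys p. Poly_Mapping.keys e \<subseteq> S},
     mult = (*), one = 1, zero = 0, add = (+)\<rparr>"

definition base_ring :: "laurent ring" where
  "base_ring = laurent_ring {Q, Theta}"


section \<open>Modules\<close>

text \<open>The multiplicative fields of the underlying ring record play no role in a module; they are
  left \<^const>\<open>undefined\<close> in all modules below.\<close>

definition quotient_module ::
    "('a, 'b, 'm) module_scheme \<Rightarrow> 'b set \<Rightarrow> ('a, 'b set) module" where
  "quotient_module M N =
     \<lparr>carrier = a_rcosets\<^bsub>M\<^esub> N, mult = undefined, one = undefined,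
      zero = N, add = set_add M, smult = (\<lambda>a C. \<Union>x\<in>C. N +>\<^bsub>M\<^esub> (a \<odot>\<^bsub>M\<^esub> x))\<rparr>"

definition module_basis ::
    "('a, 'c) ring_scheme \<Rightarrow> ('a, 'b, 'm) module_scheme \<Rightarrow> 'b set \<Rightarrow> bool" where
  "module_basis R M B \<longleftrightarrow> B \<subseteq> carrier M \<and>
     (\<forall>x\<in>carrier M. \<exists>!a. a \<in> B \<rightarrow>\<^sub>E carrier R \<and> finite {b\<in>B. a b \<noteq> \<zero>\<^bsub>R\<^esub>} \<and>
        x = (\<Oplus>\<^bsub>M\<^esub>b\<in>{b\<in>B. a b \<noteq> \<zero>\<^bsub>R\<^esub>}. a b \<odot>\<^bsub>M\<^esub> b))"

definition free_module ::
    "('a, 'c) ring_scheme \<Rightarrow> ('a, 'b, 'm) module_scheme \<Rightarrow> bool" where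
  "free_module R M \<longleftrightarrow> module R M \<and> (\<exists>B. module_basis R M B)"

definition free_module_of_rank ::
    "('a, 'c) ring_scheme \<Rightarrow> ('a, 'b, 'm) module_scheme \<Rightarrow> nat \<Rightarrow> bool" where
  "free_module_of_rank R M r \<longleftrightarrow>
     module R M \<and> (\<exists>B. module_basis R M B \<and> finite B \<and> card B = r)"

definition internal_direct_sum ::
    "('a, 'c) ring_scheme \<Rightarrow> ('a, 'b, 'm) module_scheme \<Rightarrow> 'b set \<Rightarrow> 'b set \<Rightarrow> bool" where
  "internal_direct_sum R M H K \<longleftrightarrow> submodule H R M \<and> submodule K R M \<and>
     H <+>\<^bsub>M\<^esub> K = carrier M \<and> H \<inter> K = {\<zero>\<^bsub>M\<^esub>}"

text \<open>A connection is given by its two covariant derivatives, along \<open>\<partial>\<^sub>\<theta>\<close> and \<open>q \<partial>\<^sub>q\<close>.\<close>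

definition is_connection ::
    "(laurent, 'b, 'm) module_scheme \<Rightarrow> ('b \<Rightarrow> 'b) \<Rightarrow> ('b \<Rightarrow> 'b) \<Rightarrow> bool" where
  "is_connection M Dtheta Dq \<longleftrightarrow>
     Dtheta \<in> carrier M \<rightarrow> carrier M \<and> Dq \<in> carrier M \<rightarrow> carrier M \<and>
     (\<forall>x\<in>carrier M. \<forall>y\<in>carrier M.
        Dtheta (x \<oplus>\<^bsub>M\<^esub> y) = Dtheta x \<oplus>\<^bsub>M\<^esub> Dtheta y \<and> Dq (x \<oplus>\<^bsub>M\<^esub> y) = Dq x \<oplus>\<^bsub>M\<^esub> Dq y) \<and>
     (\<forall>a\<in>carrier base_ring. \<forall>x\<in>carrier M.
        Dtheta (a \<odot>\<^bsub>M\<^esub> x) = (pdiff Theta a \<odot>\<^bsub>M\<^esub> x) \<oplus>\<^bsub>M\<^esub> (a \<odot>\<^bsub>M\<^esub> Dtheta x) \<and>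
        Dq (a \<odot>\<^bsub>M\<^esub> x) = ((xpow Q 1 * pdiff Q a) \<odot>\<^bsub>M\<^esub> x) \<oplus>\<^bsub>M\<^esub> (a \<odot>\<^bsub>M\<^esub> Dq x))"

definition is_module_iso ::
    "('a, 'c) ring_scheme \<Rightarrow> ('a, 'b, 'm) module_scheme \<Rightarrow> ('a, 'd, 'k) module_scheme
       \<Rightarrow> ('b \<Rightarrow> 'd) \<Rightarrow> bool" where
  "is_module_iso R M N \<phi> \<longleftrightarrow> bij_betw \<phi> (carrier M) (carrier N) \<and>
     (\<forall>x\<in>carrier M. \<forall>y\<in>carrier M. \<phi> (x \<oplus>\<^bsub>M\<^esub> y) = \<phi> x \<oplus>\<^bsub>N\<^esub> \<phi> y) \<and>
     (\<forall>a\<in>carrier R. \<forall>x\<in>carrier M. \<phi> (a \<odot>\<^bsub>M\<^esub> x) = a \<odot>\<^bsub>N\<^esub> \<phi> x)"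


section \<open>Differential forms on the torus\<close>

text \<open>A form \<open>\<Sum>\<^sub>I \<omega>\<^sub>I du\<^sub>I\<close>, where \<open>du\<^sub>I\<close> is the wedge product of the \<open>du\<^sub>i\<close> with \<open>i \<in> I\<close> in increasing
  order, is represented by the function \<open>I \<mapsto> \<omega>\<^sub>I\<close>.\<close>

type_synonym form = "nat set \<Rightarrow> laurent"

definition wedge :: "form \<Rightarrow> form \<Rightarrow> form" where
  "wedge \<alpha> \<beta> = (\<lambda>J. \<Sum>I\<in>Pow J.
     (-1) ^ card {(i, k). i \<in> I \<and> k \<in> J - I \<and> k < i} * \<alpha> I * \<beta> (J - I))"

text \<open>\<open>d\<omega> = \<Sum>\<^sub>I \<Sum>\<^sub>i (\<partial>\<omega>\<^sub>I / \<partial>u\<^sub>i) du\<^sub>i \<and> du\<^sub>I\<close>, relative to the parameters \<open>q\<close> and \<open>\<theta>\<close>.\<close>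

definition ext_d :: "form \<Rightarrow> form" where
  "ext_d \<omega> = (\<lambda>J. \<Sum>i\<in>J. (-1) ^ card {k\<in>J. k < i} * pdiff (U i) (\<omega> (J - {i})))"

definition zero_form :: "laurent \<Rightarrow> form" where
  "zero_form p = (\<lambda>I. if I = {} then p else 0)"

text \<open>\<open>forms n p\<close> is \<open>\<Omega>\<^sup>p(V)[q, q\<^sup>-\<^sup>1, \<theta>, \<theta>\<^sup>-\<^sup>1]\<close>, where \<open>V\<close> is the torus of dimension \<open>n - 1\<close>.\<close>

definition forms :: "nat \<Rightarrow> nat \<Rightarrow> (laurent, form) module" where
  "forms n p =
     \<lparr>carrier = {\<omega>. (\<forall>I. \<omega> I \<in> carrier (laurent_ring (U ` {1..n-1} \<union> {Q, Theta}))) \<and>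
                     (\<forall>I. \<omega> I \<noteq> 0 \<longrightarrow> I \<subseteq> {1..n-1} \<and> card I = p)},
      mult = undefined, one = undefined,
      zero = (\<lambda>I. 0), add = (\<lambda>\<alpha> \<beta> I. \<alpha> I + \<beta> I), smult = (\<lambda>a \<omega> I. a * \<omega> I)\<rparr>"


section \<open>The Gauss-Manin system of the Givental-Hori-Vafa model\<close>

definition potential :: "nat \<Rightarrow> laurent" where
  "potential n = (\<Sum>i=1..n-2. xpow (U i) 1) +
     (xpow (U (n-1)) 1 + xpow Q 1)^2 * (\<Prod>i=1..n-1. xpow (U i) (-1))"

definition GM_relations :: "nat \<Rightarrow> form set" where
  "GM_relations n =
     (\<lambda>\<eta> I. xpow Theta 1 * ext_d \<eta> I - wedge (ext_d (zero_form (potential n))) \<eta> I)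
       ` carrier (forms n (n-2))"

definition GM :: "nat \<Rightarrow> (laurent, form set) module" where
  "GM n = quotient_module (forms n (n-1)) (GM_relations n)"

text \<open>The map on classes induced by an operator on representatives; for an operator that respects
  the relations the union is over equal cosets.\<close>

definition GM_lift :: "nat \<Rightarrow> (form \<Rightarrow> form) \<Rightarrow> form set \<Rightarrow> form set" where
  "GM_lift n T C = (\<Union>\<omega>\<in>C. GM_relations n +>\<^bsub>forms n (n-1)\<^esub> T \<omega>)"

text \<open>On \<open>\<omega> = \<Sum>\<^sub>i \<omega>\<^sub>i \<theta>\<^sup>i\<close> one has \<open>\<Sum>\<^sub>i i \<omega>\<^sub>i \<theta>\<^sup>i\<^sup>+\<^sup>1 = \<theta>\<^sup>2 \<partial>\<^sub>\<theta> \<omega>\<close>; the Lie derivative along \<open>q \<partial>\<^sub>q\<close> kills the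
  \<open>du\<^sub>i\<close> and hence acts on the coefficients only.\<close>

definition GM_nabla_theta :: "nat \<Rightarrow> form set \<Rightarrow> form set" where
  "GM_nabla_theta n C = xpow Theta (-2) \<odot>\<^bsub>GM n\<^esub>
     GM_lift n (\<lambda>\<omega> I. potential n * \<omega> I + xpow Theta 2 * pdiff Theta (\<omega> I)) C"

definition GM_nabla_q :: "nat \<Rightarrow> form set \<Rightarrow> form set" where
  "GM_nabla_q n C = xpow Theta (-1) \<odot>\<^bsub>GM n\<^esub>
     GM_lift n (\<lambda>\<omega> I. xpow Theta 1 * (xpow Q 1 * pdiff Q (\<omega> I))
                        - xpow Q 1 * pdiff Q (potential n) * \<omega> I) C"


section \<open>The quantum differential system of a quadric\<close>

text \<open>An element \<open>\<Sum>\<^sub>i v\<^sub>i b\<^sub>i\<close> is represented by its coordinate function \<open>v\<close>.\<close>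

definition QD :: "nat \<Rightarrow> (laurent, nat \<Rightarrow> laurent) module" where
  "QD n =
     \<lparr>carrier = {v. (\<forall>i<n. v i \<in> carrier base_ring) \<and> (\<forall>i\<ge>n. v i = 0)},
      mult = undefined, one = undefined,
      zero = (\<lambda>i. 0), add = (\<lambda>v w i. v i + w i), smult = (\<lambda>a v i. a * v i)\<rparr>"

definition bvec :: "nat \<Rightarrow> nat \<Rightarrow> laurent" where
  "bvec i = (\<lambda>j. if j = i then 1 else 0)"

text \<open>\<open>bmult n i\<close> is the quantum product \<open>b \<circ> b\<^sub>i\<close>, for \<open>i < n\<close>.\<close>

definition bmult :: "nat \<Rightarrow> nat \<Rightarrow> nat \<Rightarrow> laurent" where
  "bmult n i = (if i \<le> n - 3 then bvec (i + 1)
     else if i = n - 2 then (\<lambda>j. bvec (n - 1) j + 2 * xpow Q 1 * bvec 0 j)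
     else (\<lambda>j. 2 * xpow Q 1 * bvec 1 j))"

text \<open>The connection is extended from the basis by the Leibniz rule.\<close>

definition QD_nabla_theta :: "nat \<Rightarrow> (nat \<Rightarrow> laurent) \<Rightarrow> nat \<Rightarrow> laurent" where
  "QD_nabla_theta n v = (\<lambda>j. \<Sum>i<n. pdiff Theta (v i) * bvec i j +
     v i * (xpow Theta (-2) * (of_nat (n - 1) * bmult n i j + of_nat i * xpow Theta 1 * bvec i j)))"

definition QD_nabla_q :: "nat \<Rightarrow> (nat \<Rightarrow> laurent) \<Rightarrow> nat \<Rightarrow> laurent" where
  "QD_nabla_q n v = (\<lambda>j. \<Sum>i<n. (xpow Q 1 * pdiff Q (v i)) * bvec i j +
     v i * (xpow Theta (-1) * (- bmult n i j)))"

end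

theory Submission
  imports Defs "HOL-Analysis.Gamma_Function" "HOL-Computational_Algebra.Polynomial"
begin

text \<open>The whole Gauss-Manin module \<open>G\<close> is free of rank \<open>n\<close>, so that \<open>H = G\<close> and \<open>H\<degree> = 0\<close>.  The isomorphism
  sends \<open>b\<^sub>0\<close> to the class of the invariant volume form \<open>\<Prod>\<^sub>i du\<^sub>i / u\<^sub>i\<close> and intertwines quantum
  multiplication by the hyperplane class with \<open>B = - \<theta> \<nabla>\<close> along \<open>q \<partial>\<^sub>q\<close>.

  In logarithmic coordinates the relations that define \<open>G\<close> are the images of the operators
  \<open>\<theta> u\<^sub>i \<partial>\<^sub>i - u\<^sub>i \<partial>\<^sub>i f\<close> on Laurent polynomials.  For the monomials \<open>X a b = u\<^sub>1\<^bsup>a\<^sub>1\<^esup> \<dots> u\<^sub>n\<^sub>-\<^sub>2\<^bsup>a\<^sub>n\<^sub>-\<^sub>2\<^esup> (u\<^sub>n\<^sub>-\<^sub>1 / q)\<^bsup>b\<^esup>\<close>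
  they say that raising \<open>a\<^sub>i\<close> is the same as applying \<open>B + a\<^sub>i \<theta>\<close>, and they express \<open>(B \<plusminus> b \<theta>) (X a b)\<close> through
  monomials with all \<open>a\<^sub>i\<close> lowered by one.  From these relations the class of \<open>1\<close> satisfies
  \<open>B\<^sup>n = 2 q (2 B - \<theta>)\<close> (\<open>quantum_differential_equation\<close>), which is the quantum differential equation of
  the quadric, so the \<open>q\<close>-connections agree (\<open>B_beta\<close>).  The \<open>\<theta>\<close>-connections then agree because \<open>f\<close> is
  homogeneous of degree one for a grading in which \<open>q\<close> has degree \<open>n - 1\<close> (\<open>theta_op_euler\<close>).

  Generation (\<open>L_subset_beta_span\<close>): the submodule generated by the images of the \<open>b\<^sub>i\<close> contains \<open>X 0 0 = 1\<close>
  and is stable under \<open>B\<close>, hence under raising the \<open>a\<^sub>i\<close>.  It is stable under lowering one of them because,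
  modulo the submodule, \<open>B\<close> acts on the lowered monomial as \<open>\<theta> / 2\<close>, and \<open>B + a \<theta>\<close> as a non-zero
  half-integral multiple of \<open>\<theta>\<close>.

  Independence (\<open>B_pow_independent\<close>): Mellin transforms in \<open>q\<close> of the integrals of \<open>exp (- f / \<theta>)\<close> are functionals
  that vanish on the relations and turn \<open>B\<close> into multiplication by the Mellin variable \<open>s\<close>.  They are
  explicit products of Gamma values, so the values \<open>E s\<close> on \<open>1\<close> satisfy
  \<open>2 (2 s + 1) E (s + 1) = s\<^sup>n E s\<close>.  The factor \<open>s\<^sup>n\<close> excludes linear relations between shifts of \<open>E\<close> with
  polynomial coefficients of degree less than \<open>n\<close> (\<open>shift_recurrence_independent\<close>).\<close>

section \<open>Logarithmic derivatives of Laurent polynomials\<close>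

definition ldiff :: "var \<Rightarrow> laurent \<Rightarrow> laurent" where
  "ldiff v p = xpow v 1 * pdiff v p"

lemma xpow_mult: "xpow v j * xpow v k = xpow v (j + k)"
  by (simp add: xpow_def mult_single single_add)

lemma xpow_0 [simp]: "xpow v 0 = 1"
  by (simp add: xpow_def)

lemma xpow_cancel: "xpow v (-1) * (xpow v 1 * p) = p" "xpow v 1 * (xpow v (-1) * p) = p"
  by (simp_all add: mult.assoc [symmetric] xpow_mult)

lemma pdiff_eq_ldiff: "pdiff v p = xpow v (-1) * ldiff v p"
  by (simp add: ldiff_def xpow_cancel)

lemma lookup_ldiff: "Poly_Mapping.lookup (ldiff v p) e
    = of_int (Poly_Mapping.lookup e v) * Poly_Mapping.lookup p e"
proof -
  have "ldiff v p = (\<Sum>e'\<in>Poly_Mapping.keys p.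
      Poly_Mapping.single e' (of_int (Poly_Mapping.lookup e' v) * Poly_Mapping.lookup p e'))"
    by (simp add: ldiff_def pdiff_def xpow_def sum_distrib_left mult_single)
  then have "Poly_Mapping.lookup (ldiff v p) e = (\<Sum>e'\<in>Poly_Mapping.keys p.
      if e' = e then of_int (Poly_Mapping.lookup e v) * Poly_Mapping.lookup p e else 0)"
    by (simp add: lookup_sum lookup_single when_def)
  then show ?thesis
    by (auto simp: in_keys_iff)
qed

lemma ldiff_single:
  "ldiff v (Poly_Mapping.single e c) = Poly_Mapping.single e (of_int (Poly_Mapping.lookup e v) * c)"
  by (rule poly_mapping_eqI) (auto simp: lookup_ldiff lookup_single when_def)

lemma ldiff_add [simp]: "ldiff v (p + p') = ldiff v p + ldiff v p'"
  and ldiff_diff [simp]: "ldiff v (p - p') = ldiff v p - ldiff v p'"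
  and ldiff_uminus [simp]: "ldiff v (- p) = - ldiff v p"
  and ldiff_0 [simp]: "ldiff v 0 = 0"
  by (rule poly_mapping_eqI, simp add: lookup_ldiff lookup_add lookup_minus algebra_simps)+

lemma ldiff_sum: "ldiff v (\<Sum>i\<in>I. p i) = (\<Sum>i\<in>I. ldiff v (p i))"
  by (rule poly_mapping_eqI) (simp add: lookup_ldiff lookup_sum sum_distrib_left)

lemma ldiff_commute: "ldiff v (ldiff w p) = ldiff w (ldiff v p)"
  by (rule poly_mapping_eqI) (simp add: lookup_ldiff)

lemma laurent_eq_sum:
  "(\<Sum>e\<in>Poly_Mapping.keys p. Poly_Mapping.single e (Poly_Mapping.lookup p e)) = (p :: laurent)"
proof (rule poly_mapping_eqI)
  fix e
  have "Poly_Mapping.lookup (\<Sum>e\<in>Poly_Mapping.keys p. Poly_Mapping.single e (Poly_Mapping.lookup p e)) e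
      = (\<Sum>e'\<in>Poly_Mapping.keys p. if e' = e then Poly_Mapping.lookup p e else 0)"
    by (simp add: lookup_sum lookup_single when_def)
  then show "Poly_Mapping.lookup (\<Sum>e\<in>Poly_Mapping.keys p.
      Poly_Mapping.single e (Poly_Mapping.lookup p e)) e = Poly_Mapping.lookup p e"
    by (auto simp: in_keys_iff)
qed

text \<open>Additive identities and closure properties need to be checked on monomials only.\<close>

lemma laurent_induct [case_names single zero add]:
  fixes p :: laurent
  assumes "\<And>e c. e \<in> Poly_Mapping.keys p \<Longrightarrow> P (Poly_Mapping.single e c)"
    and "P 0" and "\<And>a b. P a \<Longrightarrow> P b \<Longrightarrow> P (a + b)"
  shows "P p"
proof -
  have "P (\<Sum>e\<in>A. Poly_Mapping.single e (Poly_Mapping.lookup p e))"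
    if "finite A" "A \<subseteq> Poly_Mapping.keys p" for A
    using that by (induction A) (auto intro: assms)
  from this [of "Poly_Mapping.keys p"] show ?thesis
    by (simp add: laurent_eq_sum)
qed

lemma ldiff_mult: "ldiff v (p * p') = ldiff v p * p' + p * ldiff v p'"
proof (induction p rule: laurent_induct)
  case (single e c)
  show ?case
    by (induction p' rule: laurent_induct)
      (simp_all add: ldiff_single mult_single lookup_add single_add [symmetric] algebra_simps)
qed (simp_all add: algebra_simps)

lemma ldiff_xpow: "ldiff v (xpow w k) = (if v = w then of_int k * xpow w k else 0)"
  using single_of_int [of k, where ?'a = "var \<Rightarrow>\<^sub>0 int" and ?'b = complex, symmetric]
  by (auto simp: xpow_def ldiff_single mult_single lookup_single when_def simp del: single_of_int)

lemma ldiff_of_int [simp]: "ldiff v (of_int k) = 0" "ldiff v (of_nat m) = 0"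
    "ldiff v (numeral w) = 0" "ldiff v 1 = 0"
  by (rule poly_mapping_eqI; auto simp: lookup_ldiff lookup_of_int lookup_of_nat lookup_numeral lookup_one when_def)+

lemma pdiff_0 [simp]: "pdiff v 0 = 0"
  by (simp add: pdiff_eq_ldiff)

abbreviation laurent_in :: "var set \<Rightarrow> laurent set" where
  "laurent_in S \<equiv> carrier (laurent_ring S)"

lemma laurent_in_iff: "p \<in> laurent_in S \<longleftrightarrow> (\<forall>e\<in>Poly_Mapping.keys p. Poly_Mapping.keys e \<subseteq> S)"
  by (simp add: laurent_ring_def)

lemma laurent_in_mono: "p \<in> laurent_in S \<Longrightarrow> S \<subseteq> T \<Longrightarrow> p \<in> laurent_in T"
  by (auto simp: laurent_in_iff)

lemma laurent_in_add [simp]: "p \<in> laurent_in S \<Longrightarrow> p' \<in> laurent_in S \<Longrightarrow> p + p' \<in> laurent_in S"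
  using keys_add [of p p'] by (fastforce simp: laurent_in_iff)

lemma laurent_in_uminus [simp]: "p \<in> laurent_in S \<Longrightarrow> - p \<in> laurent_in S"
  by (simp add: laurent_in_iff)

lemma laurent_in_diff [simp]: "p \<in> laurent_in S \<Longrightarrow> p' \<in> laurent_in S \<Longrightarrow> p - p' \<in> laurent_in S"
  using laurent_in_add [of p S "- p'"] by simp

lemma laurent_in_mult [simp]:
  assumes "p \<in> laurent_in S" "p' \<in> laurent_in S" shows "p * p' \<in> laurent_in S"
  unfolding laurent_in_iff
proof
  fix e assume "e \<in> Poly_Mapping.keys (p * p')"
  then obtain a b where "a \<in> Poly_Mapping.keys p" "b \<in> Poly_Mapping.keys p'" "e = a + b"
    using keys_mult [of p p'] by blast
  then show "Poly_Mapping.keys e \<subseteq> S"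
    using assms keys_add [of a b] by (fastforce simp: laurent_in_iff)
qed

lemma laurent_in_single:
  "Poly_Mapping.keys e \<subseteq> S \<Longrightarrow> Poly_Mapping.single e c \<in> laurent_in S"
  by (simp add: laurent_in_iff)

lemma laurent_in_xpow [simp]: "v \<in> S \<Longrightarrow> xpow v k \<in> laurent_in S"
  by (simp add: xpow_def laurent_in_single)

lemma laurent_in_const [simp]: "0 \<in> laurent_in S" "1 \<in> laurent_in S" "of_nat m \<in> laurent_in S"
    "of_int k \<in> laurent_in S" "numeral w \<in> laurent_in S"
  by (auto simp: laurent_in_iff in_keys_iff lookup_one lookup_of_nat lookup_of_int lookup_numeral when_def
      split: if_splits)

lemma laurent_in_sum [simp]: "(\<And>i. i \<in> I \<Longrightarrow> p i \<in> laurent_in S) \<Longrightarrow> (\<Sum>i\<in>I. p i) \<in> laurent_in S"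
  by (induction I rule: infinite_finite_induct) auto

lemma laurent_in_prod [simp]: "(\<And>i. i \<in> I \<Longrightarrow> p i \<in> laurent_in S) \<Longrightarrow> (\<Prod>i\<in>I. p i) \<in> laurent_in S"
  by (induction I rule: infinite_finite_induct) auto

lemma laurent_in_power [simp]: "p \<in> laurent_in S \<Longrightarrow> p ^ k \<in> laurent_in S"
  by (induction k) auto

lemma laurent_in_ldiff [simp]: "p \<in> laurent_in S \<Longrightarrow> ldiff v p \<in> laurent_in S"
  by (auto simp: laurent_in_iff in_keys_iff lookup_ldiff)

lemma ldiff_eq_0:
  assumes "p \<in> laurent_in S" "v \<notin> S" shows "ldiff v p = 0"
proof (rule poly_mapping_eqI)
  fix e
  show "Poly_Mapping.lookup (ldiff v p) e = Poly_Mapping.lookup 0 e"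
    using assms by (auto simp: lookup_ldiff laurent_in_iff in_keys_iff subset_iff)
qed

lemma laurent_in_pdiff [simp]: "p \<in> laurent_in S \<Longrightarrow> pdiff v p \<in> laurent_in S"
  by (cases "v \<in> S") (simp_all add: pdiff_eq_ldiff ldiff_eq_0)

lemma laurent_ring_simps [simp]: "x \<otimes>\<^bsub>laurent_ring S\<^esub> y = x * y" "x \<oplus>\<^bsub>laurent_ring S\<^esub> y = x + y"
    "\<one>\<^bsub>laurent_ring S\<^esub> = 1" "\<zero>\<^bsub>laurent_ring S\<^esub> = 0"
  by (simp_all add: laurent_ring_def)

lemma cring_laurent_ring: "cring (laurent_ring S)"
proof (rule cringI)
  show "abelian_group (laurent_ring S)"
  proof (rule abelian_groupI)
    fix x assume "x \<in> laurent_in S"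
    then show "\<exists>y\<in>laurent_in S. y \<oplus>\<^bsub>laurent_ring S\<^esub> x = \<zero>\<^bsub>laurent_ring S\<^esub>"
      by (intro bexI [of _ "- x"]) auto
  qed (auto simp: algebra_simps)
  show "Group.comm_monoid (laurent_ring S)"
    by (rule comm_monoidI) (auto simp: algebra_simps)
qed (auto simp: algebra_simps)

section \<open>The Gauss-Manin system in logarithmic coordinates\<close>

(* The index sets {1..n-1} and {1..n-2} are to keep their literal bound 1. *)
declare One_nat_def [simp del]

locale quadric =
  fixes n :: nat
  assumes n_ge_3: "3 \<le> n"
begin

abbreviation \<theta> :: laurent where "\<theta> \<equiv> xpow Theta 1"
abbreviation q :: laurent where "q \<equiv> xpow Q 1"
abbreviation u :: laurent where "u \<equiv> xpow (U (n - 1)) 1"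
abbreviation f :: laurent where "f \<equiv> potential n"
abbreviation base :: "laurent set" where "base \<equiv> carrier base_ring"

definition L :: "laurent set" where "L = laurent_in (U ` {1..n-1} \<union> {Q, Theta})"
definition tvol :: laurent where "tvol = (\<Prod>i=1..n-1. xpow (U i) (-1))"
definition F :: laurent where "F = (u + q)^2 * tvol"

text \<open>Conjugating \<open>\<theta> \<partial>\<^sub>v\<close>, with \<open>\<partial>\<^sub>v\<close> logarithmic, by \<open>exp (f / \<theta>)\<close> gives \<open>\<theta> \<partial>\<^sub>v - \<partial>\<^sub>v f\<close>; hence these
  operators commute with each other for \<open>v\<close> other than \<open>\<theta>\<close>.  Those with \<open>v = u\<^sub>i\<close> span the relations.\<close>

definition twisted :: "var \<Rightarrow> laurent \<Rightarrow> laurent" where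
  "twisted v h = \<theta> * ldiff v h - ldiff v f * h"

text \<open>\<open>B\<close> represents \<open>- \<theta> \<nabla>\<close> along \<open>q \<partial>\<^sub>q\<close>, and \<open>theta_op\<close> represents \<open>\<theta>\<^sup>2 \<nabla>\<close> along \<open>\<partial>\<^sub>\<theta>\<close>.\<close>

definition B :: "laurent \<Rightarrow> laurent" where
  "B h = - twisted Q h"

definition theta_op :: "laurent \<Rightarrow> laurent" where
  "theta_op h = f * h + \<theta> * ldiff Theta h"

definition Rel :: "laurent set" where
  "Rel = {\<Sum>i=1..n-1. twisted (U i) (h i) | h. \<forall>i. h i \<in> L}"

lemma twisted_add: "twisted v (a + b) = twisted v a + twisted v b"
  and twisted_diff: "twisted v (a - b) = twisted v a - twisted v b"
  and twisted_0 [simp]: "twisted v 0 = 0"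
  by (simp_all add: twisted_def algebra_simps)

lemma B_add: "B (a + b) = B a + B b"
  and B_diff: "B (a - b) = B a - B b"
  and B_0 [simp]: "B 0 = 0"
  by (simp_all add: B_def twisted_add twisted_diff)

lemma B_sum: "B (\<Sum>i\<in>I. a i) = (\<Sum>i\<in>I. B (a i))"
  by (induction I rule: infinite_finite_induct) (simp_all add: B_add)

lemma B_mult: "B (a * h) = a * B h - \<theta> * ldiff Q a * h"
  by (simp add: B_def twisted_def ldiff_mult algebra_simps)

lemma L_closed [simp]:
  "p \<in> L \<Longrightarrow> p' \<in> L \<Longrightarrow> p + p' \<in> L" "p \<in> L \<Longrightarrow> - p \<in> L"
  "p \<in> L \<Longrightarrow> p' \<in> L \<Longrightarrow> p - p' \<in> L" "p \<in> L \<Longrightarrow> p' \<in> L \<Longrightarrow> p * p' \<in> L"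
  "p \<in> L \<Longrightarrow> p ^ k \<in> L" "0 \<in> L" "1 \<in> L" "of_nat m \<in> L" "of_int j \<in> L" "numeral w \<in> L"
  "p \<in> L \<Longrightarrow> ldiff v p \<in> L" "p \<in> L \<Longrightarrow> pdiff v p \<in> L"
  by (simp_all add: L_def)

lemma L_sum [simp]: "(\<And>i. i \<in> I \<Longrightarrow> p i \<in> L) \<Longrightarrow> (\<Sum>i\<in>I. p i) \<in> L"
  and L_prod [simp]: "(\<And>i. i \<in> I \<Longrightarrow> p i \<in> L) \<Longrightarrow> (\<Prod>i\<in>I. p i) \<in> L"
  by (simp_all add: L_def)

lemma base_subset: "base \<subseteq> L"
  unfolding base_ring_def L_def using laurent_in_mono by blast

lemma base_in_L [simp]: "a \<in> base \<Longrightarrow> a \<in> L"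
  using base_subset by blast

lemma base_iff: "a \<in> base \<longleftrightarrow> a \<in> laurent_in {Q, Theta}"
  by (simp add: base_ring_def)

lemma ldiff_U_base [simp]: "a \<in> base \<Longrightarrow> ldiff (U i) a = 0"
  by (rule ldiff_eq_0 [of _ "{Q, Theta}"]) (auto simp: base_ring_def)

lemma U_in_L [simp]: "1 \<le> i \<Longrightarrow> i \<le> n - 1 \<Longrightarrow> xpow (U i) k \<in> L"
  unfolding L_def by (rule laurent_in_xpow) auto

lemma u_in_L [simp]: "u \<in> L" "q \<in> L" "\<theta> \<in> L" "xpow Q k \<in> L" "xpow Theta k \<in> L"
  using n_ge_3 by (auto simp: L_def intro!: laurent_in_xpow)

lemma tvol_in_L [simp]: "tvol \<in> L"
  unfolding tvol_def by (rule L_prod) simp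

lemma F_in_L [simp]: "F \<in> L"
  by (simp add: F_def)

lemma potential_eq: "f = (\<Sum>i=1..n-2. xpow (U i) 1) + F"
  by (simp add: potential_def F_def tvol_def)

lemma potential_in_L [simp]: "f \<in> L"
  unfolding potential_eq by (intro L_closed L_sum) auto

lemma twisted_in_L [simp]: "h \<in> L \<Longrightarrow> twisted v h \<in> L"
  by (simp add: twisted_def)

lemma B_in_L [simp]: "h \<in> L \<Longrightarrow> B h \<in> L"
  by (simp add: B_def)

lemma theta_op_in_L [simp]: "h \<in> L \<Longrightarrow> theta_op h \<in> L"
  by (simp add: theta_op_def)

text \<open>This factor of \<open>tvol\<close> is constant in \<open>u\<^sub>i\<close>, so it commutes with \<open>\<partial> / \<partial>u\<^sub>i\<close>.\<close>

definition tvol_except :: "nat \<Rightarrow> laurent" where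
  "tvol_except i = (\<Prod>k\<in>{1..n-1} - {i}. xpow (U k) (-1))"

lemma tvol_split: "i \<in> {1..n-1} \<Longrightarrow> tvol = xpow (U i) (-1) * tvol_except i"
  unfolding tvol_def tvol_except_def by (rule prod.remove) auto

lemma prod_xpow_inverse: "(\<Prod>k\<in>A. xpow (U k) (-1)) * (\<Prod>k\<in>A. xpow (U k) 1) = 1"
  by (simp add: prod.distrib [symmetric] xpow_mult)

lemma ldiff_tvol_except: "ldiff (U i) (tvol_except i) = 0" "ldiff Q (tvol_except i) = 0"
    "ldiff Theta (tvol_except i) = 0"
  by (rule ldiff_eq_0 [of _ "U ` ({1..n-1} - {i})"]; (auto simp: tvol_except_def intro!: laurent_in_prod laurent_in_xpow)?)+

lemma ldiff_tvol: "i \<in> {1..n-1} \<Longrightarrow> ldiff (U i) tvol = - tvol" "ldiff Q tvol = 0" "ldiff Theta tvol = 0"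
proof -
  show "ldiff (U i) tvol = - tvol" if "i \<in> {1..n-1}"
    by (simp add: tvol_split [OF that] ldiff_mult ldiff_xpow ldiff_tvol_except)
  have *: "1 \<in> {1..n-1}"
    using n_ge_3 by auto
  show "ldiff Q tvol = 0" "ldiff Theta tvol = 0"
    unfolding tvol_split [OF *] by (simp_all add: ldiff_mult ldiff_xpow ldiff_tvol_except)
qed

lemma ldiff_potential_Theta: "ldiff Theta f = 0"
  by (simp add: potential_eq F_def ldiff_sum ldiff_mult ldiff_tvol power2_eq_square ldiff_xpow)

lemma ldiff_potential_Q: "ldiff Q f = 2 * q * (u + q) * tvol"
  by (simp add: potential_eq F_def ldiff_sum ldiff_mult ldiff_tvol power2_eq_square ldiff_xpow algebra_simps)

lemma ldiff_potential_u: "ldiff (U (n-1)) f = (u^2 - q^2) * tvol"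
proof -
  have "n - 1 \<in> {1..n-1}" "\<And>i. i \<in> {1..n-2} \<Longrightarrow> n - 1 \<noteq> i"
    using n_ge_3 by auto
  then have "ldiff (U (n-1)) (\<Sum>i=1..n-2. xpow (U i) 1) = 0" "ldiff (U (n-1)) tvol = - tvol"
    by (auto simp: ldiff_sum ldiff_xpow ldiff_tvol intro!: sum.neutral)
  then show ?thesis
    by (simp add: potential_eq F_def ldiff_mult power2_eq_square ldiff_xpow algebra_simps)
qed

lemma ldiff_potential_U:
  assumes "i \<in> {1..n-2}" shows "ldiff (U i) f = xpow (U i) 1 - F"
proof -
  have *: "i \<in> {1..n-1}" "n - 1 \<noteq> i"
    using assms n_ge_3 by auto
  have "ldiff (U i) (\<Sum>k=1..n-2. xpow (U k) 1) = (\<Sum>k=1..n-2. if k = i then xpow (U i) 1 else 0)"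
    unfolding ldiff_sum by (rule sum.cong) (auto simp: ldiff_xpow)
  with assms * show ?thesis
    by (simp add: potential_eq F_def ldiff_mult power2_eq_square ldiff_xpow ldiff_tvol algebra_simps)
qed

lemma ldiff_potential_uQ: "ldiff (U (n-1)) f + ldiff Q f = F"
  by (simp add: ldiff_potential_u ldiff_potential_Q F_def power2_eq_square algebra_simps)

lemma twisted_commute: "twisted (U i) (twisted Q h) = twisted Q (twisted (U i) h)"
  by (simp add: twisted_def ldiff_mult ldiff_xpow ldiff_commute [of "U i" Q] algebra_simps)

text \<open>\<open>theta_op\<close> differentiates the factor \<open>\<theta>\<close> in \<open>twisted\<close>; the extra term is again a relation.\<close>

lemma theta_op_twisted: "theta_op (twisted (U i) h) = twisted (U i) (theta_op h + \<theta> * h)"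
  by (simp add: twisted_def theta_op_def ldiff_mult ldiff_xpow ldiff_commute [of Theta "U i"]
      ldiff_potential_Theta algebra_simps)

lemma twisted_base_mult: "a \<in> base \<Longrightarrow> twisted (U i) (a * h) = a * twisted (U i) h"
  by (simp add: twisted_def ldiff_mult algebra_simps)

lemma RelI: "(\<And>i. h i \<in> L) \<Longrightarrow> (\<Sum>i=1..n-1. twisted (U i) (h i)) \<in> Rel"
  by (auto simp: Rel_def)

lemma RelE: assumes "r \<in> Rel" obtains h where "\<And>i. h i \<in> L" "r = (\<Sum>i=1..n-1. twisted (U i) (h i))"
  using assms by (auto simp: Rel_def)

lemma twisted_in_Rel: assumes "i \<in> {1..n-1}" "h \<in> L" shows "twisted (U i) h \<in> Rel"
proof -
  have "(\<Sum>k=1..n-1. twisted (U k) (if k = i then h else 0)) = (\<Sum>k=1..n-1. if k = i then twisted (U i) h else 0)"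
    by (rule sum.cong) auto
  with assms RelI [of "\<lambda>k. if k = i then h else 0"] show ?thesis
    by (simp add: if_distrib)
qed

lemma Rel_0 [simp]: "0 \<in> Rel"
  using twisted_in_Rel [of 1 0] n_ge_3 by simp

lemma Rel_add: "r \<in> Rel \<Longrightarrow> s \<in> Rel \<Longrightarrow> r + s \<in> Rel"
  by (elim RelE) (auto simp: sum.distrib [symmetric] twisted_add [symmetric] intro!: RelI)

lemma Rel_base_mult: "a \<in> base \<Longrightarrow> r \<in> Rel \<Longrightarrow> a * r \<in> Rel"
  by (elim RelE) (auto simp: sum_distrib_left twisted_base_mult [symmetric] intro!: RelI)

lemma Rel_uminus: "r \<in> Rel \<Longrightarrow> - r \<in> Rel"
  using Rel_base_mult [of "-1" r] by (simp add: base_iff)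

lemma Rel_diff: "r \<in> Rel \<Longrightarrow> s \<in> Rel \<Longrightarrow> r - s \<in> Rel"
  using Rel_add [of r "- s"] Rel_uminus by simp

lemma Rel_sum: "(\<And>i. i \<in> I \<Longrightarrow> r i \<in> Rel) \<Longrightarrow> (\<Sum>i\<in>I. r i) \<in> Rel"
  by (induction I rule: infinite_finite_induct) (auto intro: Rel_add)

lemma B_Rel: assumes "r \<in> Rel" shows "B r \<in> Rel"
proof -
  obtain h where h: "\<And>i. h i \<in> L" "r = (\<Sum>i=1..n-1. twisted (U i) (h i))"
    using assms by (rule RelE) blast
  have "B r = (\<Sum>i=1..n-1. - twisted (U i) (twisted Q (h i)))"
    unfolding h(2) B_sum by (simp add: B_def twisted_commute)
  with h show ?thesis
    by (auto intro!: Rel_sum Rel_uminus twisted_in_Rel)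
qed

lemma theta_op_Rel: assumes "r \<in> Rel" shows "theta_op r \<in> Rel"
proof -
  obtain h where h: "\<And>i. h i \<in> L" "r = (\<Sum>i=1..n-1. twisted (U i) (h i))"
    using assms by (rule RelE) blast
  have "theta_op r = (\<Sum>i=1..n-1. theta_op (twisted (U i) (h i)))"
    unfolding h(2) theta_op_def by (simp add: ldiff_sum sum_distrib_left sum.distrib)
  with h show ?thesis
    by (auto simp: theta_op_twisted intro!: RelI)
qed

section \<open>Classes of top-degree forms\<close>

text \<open>\<open>top_form h\<close> is the multiple \<open>h \<Prod>\<^sub>i du\<^sub>i / u\<^sub>i\<close> of the invariant volume form.\<close>

definition top_form :: "laurent \<Rightarrow> form" where
  "top_form h = (\<lambda>I. if I = {1..n-1} then tvol * h else 0)"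

lemma top_add: "(\<lambda>I. top_form a I + top_form b I) = top_form (a + b)"
  by (auto simp: top_form_def algebra_simps)

lemma top_mult: "(\<lambda>I. a * top_form b I) = top_form (a * b)"
  by (auto simp: top_form_def)

lemma tvol_inverse: "tvol * ((\<Prod>k=1..n-1. xpow (U k) 1) * p) = p"
  using prod_xpow_inverse [of "{1..n-1}"] by (simp add: tvol_def mult.assoc [symmetric])

lemma top_inj: "top_form a = top_form b \<longleftrightarrow> a = b"
proof
  assume "top_form a = top_form b"
  then have "top_form a {1..n-1} = top_form b {1..n-1}" by simp
  then have "(\<Prod>k=1..n-1. xpow (U k) 1) * (tvol * a) = (\<Prod>k=1..n-1. xpow (U k) 1) * (tvol * b)"
    by (simp add: top_form_def)
  moreover have "(\<Prod>k=1..n-1. xpow (U k) 1) * (tvol * p) = p" for p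
    using tvol_inverse [of p] by (simp add: mult.left_commute)
  ultimately show "a = b" by simp
qed simp

lemma forms_carrier: "\<omega> \<in> carrier (forms n p)
    \<longleftrightarrow> (\<forall>I. \<omega> I \<in> L) \<and> (\<forall>I. \<omega> I \<noteq> 0 \<longrightarrow> I \<subseteq> {1..n-1} \<and> card I = p)"
  by (simp add: forms_def L_def)

lemma carrier_top_forms: "carrier (forms n (n-1)) = top_form ` L"
proof (intro equalityI subsetI)
  fix \<omega> assume \<omega>: "\<omega> \<in> carrier (forms n (n-1))"
  let ?h = "(\<Prod>k=1..n-1. xpow (U k) 1) * \<omega> {1..n-1}"
  have "\<omega> I = 0" if "I \<noteq> {1..n-1}" for I
    using \<omega> that card_subset_eq [of "{1..n-1}" I] by (auto simp: forms_carrier)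
  then have "\<omega> = top_form ?h"
    unfolding top_form_def tvol_inverse by auto
  moreover have "?h \<in> L"
    using \<omega> by (intro L_closed L_prod) (auto simp: forms_carrier)
  ultimately show "\<omega> \<in> top_form ` L" by blast
next
  fix \<omega> assume "\<omega> \<in> top_form ` L"
  then show "\<omega> \<in> carrier (forms n (n-1))"
    by (auto simp: forms_carrier top_form_def split: if_splits)
qed

text \<open>The left factor is a one-form, so only the singletons \<open>I = {i}\<close> contribute to the wedge product.\<close>

lemma wedge_ext_d_zero_form:
  assumes "finite J"
  shows "wedge (ext_d (zero_form p)) \<eta> J
    = (\<Sum>i\<in>J. (-1) ^ card {k\<in>J. k < i} * pdiff (U i) p * \<eta> (J - {i}))"
proof -
  have d_single: "ext_d (zero_form p) {i} = pdiff (U i) p" for i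
  proof -
    have *: "{k. k = i \<and> k < i} = {}"
      by auto
    show ?thesis
      by (simp add: ext_d_def zero_form_def *)
  qed
  have d_0: "ext_d (zero_form p) I = 0" if "\<nexists>i. I = {i}" for I
  proof -
    have "I - {i} \<noteq> {}" if "i \<in> I" for i
      using \<open>\<nexists>i. I = {i}\<close> that by blast
    then show ?thesis
      by (auto simp: ext_d_def zero_form_def intro!: sum.neutral)
  qed
  have sign: "card {(i', k). i' \<in> {i} \<and> k \<in> J - {i} \<and> k < i'} = card {k\<in>J. k < i}" for i
  proof -
    have "{(i', k). i' \<in> {i} \<and> k \<in> J - {i} \<and> k < i'} = Pair i ` {k\<in>J. k < i}"
      by auto
    then show ?thesis
      by (simp add: card_image inj_on_def)
  qed
  have "wedge (ext_d (zero_form p)) \<eta> J = (\<Sum>I\<in>(\<lambda>i. {i}) ` J.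
     (-1) ^ card {(i, k). i \<in> I \<and> k \<in> J - I \<and> k < i} * ext_d (zero_form p) I * \<eta> (J - I))"
    unfolding wedge_def
  proof (rule sum.mono_neutral_right)
    show "\<forall>I\<in>Pow J - (\<lambda>i. {i}) ` J.
      (-1) ^ card {(i, k). i \<in> I \<and> k \<in> J - I \<and> k < i} * ext_d (zero_form p) I * \<eta> (J - I) = 0"
    proof
      fix I assume "I \<in> Pow J - (\<lambda>i. {i}) ` J"
      then have "\<nexists>i. I = {i}" by auto
      then show "(-1) ^ card {(i, k). i \<in> I \<and> k \<in> J - I \<and> k < i} * ext_d (zero_form p) I * \<eta> (J - I) = 0"
        by (simp add: d_0)
    qed
  qed (use assms in auto)
  also have "\<dots> = (\<Sum>i\<in>J. (-1) ^ card {k\<in>J. k < i} * pdiff (U i) p * \<eta> (J - {i}))"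
    by (subst sum.reindex) (auto simp: sign [simplified] d_single)
  finally show ?thesis .
qed

definition rel_form :: "form \<Rightarrow> form" where
  "rel_form \<eta> = (\<lambda>I. \<theta> * ext_d \<eta> I - wedge (ext_d (zero_form f)) \<eta> I)"

lemma rel_form_eq: "rel_form \<eta> J = (\<Sum>i\<in>J. (-1) ^ card {k\<in>J. k < i} *
    (\<theta> * pdiff (U i) (\<eta> (J - {i})) - pdiff (U i) f * \<eta> (J - {i})))"
proof (cases "finite J")
  case True
  then show ?thesis
    unfolding rel_form_def wedge_ext_d_zero_form [OF True] unfolding ext_d_def
    by (simp add: sum_distrib_left sum_subtractf [symmetric] algebra_simps)
next
  case False
  then show ?thesis
    by (simp add: rel_form_def ext_d_def wedge_def)
qed

text \<open>Such a \<open>J\<close> can carry a coefficient only if exactly one of its indices is outside \<open>{1..n-1}\<close>, and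
  all coefficients, as well as \<open>f\<close>, are constant in the corresponding variable.\<close>

lemma rel_form_eq_0:
  assumes "\<eta> \<in> carrier (forms n (n-2))" "J \<noteq> {1..n-1}"
  shows "rel_form \<eta> J = 0"
  unfolding rel_form_eq
proof (rule sum.neutral, safe)
  fix i assume i: "i \<in> J"
  let ?S = "U ` {1..n-1} \<union> {Q, Theta}"
  have \<eta>: "\<eta> I \<in> L" "\<eta> I \<noteq> 0 \<Longrightarrow> I \<subseteq> {1..n-1} \<and> card I = n - 2" for I
    using assms(1) by (auto simp: forms_carrier)
  show "(-1) ^ card {k\<in>J. k < i} *
    (\<theta> * pdiff (U i) (\<eta> (J - {i})) - pdiff (U i) f * \<eta> (J - {i})) = 0"
  proof (cases "\<eta> (J - {i}) = 0")
    case False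
    then have J: "J - {i} \<subseteq> {1..n-1}" "card (J - {i}) = n - 2"
      using \<eta> by auto
    then have "finite (J - {i})"
      using finite_subset by blast
    then have "card J = n - 1"
      using J i n_ge_3 by simp
    have "i \<notin> {1..n-1}"
    proof
      assume "i \<in> {1..n-1}"
      with J(1) have "J \<subseteq> {1..n-1}" by blast
      with \<open>card J = n - 1\<close> show False
        using assms(2) card_subset_eq [of "{1..n-1}" J] by auto
    qed
    then have "U i \<notin> ?S" by auto
    then have "pdiff (U i) p = 0" if "p \<in> L" for p
      using that unfolding L_def by (simp add: pdiff_eq_ldiff ldiff_eq_0)
    then show ?thesis
      using \<eta>(1) by simp
  qed simp
qed

lemma pdiff_twisted:
  assumes "i \<in> {1..n-1}"
  shows "\<theta> * pdiff (U i) (tvol_except i * h) - pdiff (U i) f * (tvol_except i * h)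
    = tvol * twisted (U i) h"
  by (simp add: pdiff_eq_ldiff ldiff_mult ldiff_tvol_except tvol_split [OF assms] twisted_def algebra_simps)

lemma GM_relations_eq: "GM_relations n = top_form ` Rel"
proof (intro equalityI subsetI)
  fix \<omega> assume "\<omega> \<in> GM_relations n"
  then obtain \<eta> where \<eta>: "\<eta> \<in> carrier (forms n (n-2))" and \<omega>: "\<omega> = rel_form \<eta>"
    unfolding GM_relations_def rel_form_def by blast
  \<comment> \<open>the coefficient of \<open>\<eta>\<close> without \<open>du\<^sub>i\<close>, up to sign and relative to the logarithmic forms \<open>du\<^sub>k / u\<^sub>k\<close>\<close>
  define h where "h i = (if i \<in> {1..n-1} then (-1) ^ card {k\<in>{1..n-1}. k < i} *
    ((\<Prod>k\<in>{1..n-1} - {i}. xpow (U k) 1) * \<eta> ({1..n-1} - {i})) else 0)" for i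
  have h_L: "h i \<in> L" for i
    using \<eta> unfolding h_def
    by (auto simp: forms_carrier intro!: L_closed L_prod)
  have sign: "(-1) ^ m * ((-1) ^ m * p) = p" for m and p :: laurent
    by (simp add: mult.assoc [symmetric] power_mult_distrib [symmetric])
  have "(-1) ^ card {k\<in>{1..n-1}. k < i} *
      (\<theta> * pdiff (U i) (\<eta> ({1..n-1} - {i})) - pdiff (U i) f * \<eta> ({1..n-1} - {i}))
      = tvol * twisted (U i) (h i)" if i: "i \<in> {1..n-1}" for i
  proof -
    let ?s = "(-1) ^ card {k\<in>{1..n-1}. k < i} :: laurent"
    have "tvol_except i * (?s * h i) = \<eta> ({1..n-1} - {i})"
      using i prod_xpow_inverse [of "{1..n-1} - {i}"]
      by (simp add: h_def sign tvol_except_def mult.assoc [symmetric])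
    then have "(\<theta> * pdiff (U i) (\<eta> ({1..n-1} - {i})) - pdiff (U i) f * \<eta> ({1..n-1} - {i}))
        = tvol * twisted (U i) (?s * h i)"
      using pdiff_twisted [OF i, of "?s * h i"] by simp
    also have "twisted (U i) (?s * h i) = ?s * twisted (U i) (h i)"
      by (rule twisted_base_mult) (simp add: base_iff)
    finally show ?thesis
      by (simp add: sign mult.left_commute)
  qed
  then have "rel_form \<eta> {1..n-1} = tvol * (\<Sum>i=1..n-1. twisted (U i) (h i))"
    by (simp add: rel_form_eq sum_distrib_left)
  then have "rel_form \<eta> = top_form (\<Sum>i=1..n-1. twisted (U i) (h i))"
    using rel_form_eq_0 [OF \<eta>] by (auto simp: top_form_def)
  then show "\<omega> \<in> top_form ` Rel"
    using \<omega> RelI [of h] h_L by blast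
next
  fix \<omega> assume "\<omega> \<in> top_form ` Rel"
  then obtain h where h: "\<And>i. h i \<in> L" and \<omega>: "\<omega> = top_form (\<Sum>i=1..n-1. twisted (U i) (h i))"
    by (auto simp: Rel_def)
  define g where "g i = (-1) ^ card {k\<in>{1..n-1}. k < i} * (tvol_except i * h i)" for i
  define \<eta> where "\<eta> I = (\<Sum>i=1..n-1. if I = {1..n-1} - {i} then g i else 0)" for I
  have tL: "tvol_except i \<in> L" for i
    by (auto simp: tvol_except_def intro!: L_prod)
  have gL: "g i \<in> L" for i
    using h tL unfolding g_def by (intro L_closed) auto
  have \<eta>: "\<eta> \<in> carrier (forms n (n-2))"
  proof -
    have "\<eta> I \<in> L" for I
      using gL unfolding \<eta>_def by (intro L_sum) auto
    moreover have "I \<subseteq> {1..n-1} \<and> card I = n - 2" if "\<eta> I \<noteq> 0" for I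
    proof -
      have "\<exists>i\<in>{1..n-1}. I = {1..n-1} - {i}"
      proof (rule ccontr)
        assume "\<not> ?thesis"
        then have "\<eta> I = 0"
          unfolding \<eta>_def by (intro sum.neutral) auto
        with that show False by simp
      qed
      then show ?thesis by auto
    qed
    ultimately show ?thesis by (simp add: forms_carrier)
  qed
  have \<eta>_eq: "\<eta> ({1..n-1} - {i}) = g i" if "i \<in> {1..n-1}" for i
  proof -
    have "\<eta> ({1..n-1} - {i}) = (\<Sum>k=1..n-1. if k = i then g i else 0)"
      unfolding \<eta>_def
    proof (rule sum.cong [OF refl])
      fix k assume "k \<in> {1..n-1}"
      then have "{1..n-1} - {i} = {1..n-1} - {k} \<longleftrightarrow> k = i"
        using that by blast
      then show "(if {1..n-1} - {i} = {1..n-1} - {k} then g k else 0) = (if k = i then g i else 0)"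
        by simp
    qed
    then show ?thesis
      using that by simp
  qed
  have "rel_form \<eta> {1..n-1} = (\<Sum>i=1..n-1. tvol * twisted (U i) (h i))"
    unfolding rel_form_eq
  proof (rule sum.cong [OF refl])
    fix i assume i: "i \<in> {1..n-1}"
    let ?s = "(-1) ^ card {k\<in>{1..n-1}. k < i} :: laurent"
    have s: "?s \<in> base" "?s * (?s * p) = p" for p
      by (simp_all add: base_iff mult.assoc [symmetric] power_mult_distrib [symmetric])
    have "\<theta> * pdiff (U i) (\<eta> ({1..n-1} - {i})) - pdiff (U i) f * \<eta> ({1..n-1} - {i})
        = tvol * twisted (U i) (?s * h i)"
      using pdiff_twisted [OF i, of "?s * h i"] by (simp add: \<eta>_eq [OF i] g_def mult.left_commute)
    also have "\<dots> = ?s * (tvol * twisted (U i) (h i))"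
      unfolding twisted_base_mult [OF s(1)] by (rule mult.left_commute)
    finally show "?s * (\<theta> * pdiff (U i) (\<eta> ({1..n-1} - {i})) - pdiff (U i) f * \<eta> ({1..n-1} - {i}))
        = tvol * twisted (U i) (h i)"
      by (simp only: s(2))
  qed
  then have "rel_form \<eta> = \<omega>"
    using rel_form_eq_0 [OF \<eta>] by (auto simp: top_form_def \<omega> sum_distrib_left)
  with \<eta> show "\<omega> \<in> GM_relations n"
    unfolding GM_relations_def rel_form_def by blast
qed

definition cls :: "laurent \<Rightarrow> form set" where
  "cls h = GM_relations n +>\<^bsub>forms n (n-1)\<^esub> top_form h"

lemma cls_eq: "cls h = top_form ` ((\<lambda>r. r + h) ` Rel)"
  by (auto simp: cls_def a_r_coset_def' GM_relations_eq forms_def top_add image_iff)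

lemma cls_cong: "cls h = cls h' \<longleftrightarrow> h - h' \<in> Rel"
proof
  assume "cls h = cls h'"
  moreover have "top_form h \<in> cls h"
    unfolding cls_eq by (intro imageI image_eqI [of _ _ 0]) auto
  ultimately obtain r where "r \<in> Rel" "top_form h = top_form (r + h')"
    by (auto simp: cls_eq)
  then show "h - h' \<in> Rel" by (simp add: top_inj)
next
  have *: "cls a \<subseteq> cls b" if "a - b \<in> Rel" for a b
  proof
    fix x assume "x \<in> cls a"
    then obtain r where r: "r \<in> Rel" "x = top_form (r + a)" by (auto simp: cls_eq)
    then have "r + (a - b) \<in> Rel" "x = top_form ((r + (a - b)) + b)"
      using that Rel_add by auto
    then show "x \<in> cls b" unfolding cls_eq by blast
  qed
  assume "h - h' \<in> Rel"
  then show "cls h = cls h'"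
    using * [of h h'] * [of h' h] Rel_uminus [of "h - h'"] by auto
qed

lemma GM_carrier: "carrier (GM n) = cls ` L"
  by (simp add: GM_def quotient_module_def A_RCOSETS_def' cls_def carrier_top_forms UNION_eq image_def)
     blast

lemma GM_zero: "\<zero>\<^bsub>GM n\<^esub> = cls 0"
  by (simp add: GM_def quotient_module_def cls_eq GM_relations_eq)

lemma GM_add: "cls a \<oplus>\<^bsub>GM n\<^esub> cls b = cls (a + b)"
proof -
  have "cls a \<oplus>\<^bsub>GM n\<^esub> cls b = {x. \<exists>r\<in>Rel. \<exists>s\<in>Rel. x = top_form ((r + a) + (s + b))}"
    by (auto simp: GM_def quotient_module_def set_add_def' forms_def cls_eq top_add)
  also have "\<dots> = cls (a + b)"
  proof (intro equalityI subsetI)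
    fix x assume "x \<in> {x. \<exists>r\<in>Rel. \<exists>s\<in>Rel. x = top_form ((r + a) + (s + b))}"
    then obtain r s where "r \<in> Rel" "s \<in> Rel" "x = top_form ((r + s) + (a + b))"
      by (auto simp: algebra_simps)
    then show "x \<in> cls (a + b)"
      using Rel_add unfolding cls_eq by blast
  next
    fix x assume "x \<in> cls (a + b)"
    then obtain r where "r \<in> Rel" "x = top_form ((r + a) + (0 + b))"
      by (auto simp: cls_eq algebra_simps)
    then show "x \<in> {x. \<exists>r\<in>Rel. \<exists>s\<in>Rel. x = top_form ((r + a) + (s + b))}"
      using Rel_0 by blast
  qed
  finally show ?thesis .
qed

text \<open>All representatives of a class contribute the same coset to the unions by which the module
  operations are defined.\<close>

lemma Union_cosets:
  assumes "\<And>r. r \<in> Rel \<Longrightarrow> T (top_form (r + h)) = top_form (t (r + h))"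
    and "\<And>r. r \<in> Rel \<Longrightarrow> t (r + h) - t h \<in> Rel"
  shows "(\<Union>\<omega>\<in>cls h. GM_relations n +>\<^bsub>forms n (n-1)\<^esub> T \<omega>) = cls (t h)"
proof -
  have "GM_relations n +>\<^bsub>forms n (n-1)\<^esub> T \<omega> = cls (t h)" if "\<omega> \<in> cls h" for \<omega>
  proof -
    obtain r where "r \<in> Rel" "\<omega> = top_form (r + h)"
      using \<open>\<omega> \<in> cls h\<close> by (auto simp: cls_eq)
    then show ?thesis
      using assms cls_cong by (simp flip: cls_def)
  qed
  moreover have "cls h \<noteq> {}"
    using Rel_0 unfolding cls_eq by blast
  ultimately show ?thesis by auto
qed

lemma GM_smult:
  assumes "a \<in> base" shows "a \<odot>\<^bsub>GM n\<^esub> cls h = cls (a * h)"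
proof -
  have "a \<odot>\<^bsub>GM n\<^esub> cls h
      = (\<Union>\<omega>\<in>cls h. GM_relations n +>\<^bsub>forms n (n-1)\<^esub> (\<lambda>I. a * \<omega> I))"
    by (simp add: GM_def quotient_module_def forms_def)
  also have "\<dots> = cls (a * h)"
    by (rule Union_cosets) (simp_all add: top_mult distrib_left Rel_base_mult assms)
  finally show ?thesis .
qed

lemma xpow_base [simp]: "xpow Theta k \<in> base" "xpow Q k \<in> base"
  by (simp_all add: base_iff)

lemma GM_nabla_theta_cls: "GM_nabla_theta n (cls h) = cls (xpow Theta (-2) * theta_op h)"
proof -
  have "GM_lift n (\<lambda>\<omega> I. f * \<omega> I + xpow Theta 2 * pdiff Theta (\<omega> I)) (cls h) = cls (theta_op h)"
    unfolding GM_lift_def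
  proof (rule Union_cosets)
    fix r assume r: "r \<in> Rel"
    have "xpow Theta 2 * (xpow Theta (-1) * p) = \<theta> * p" for p
      by (simp add: mult.assoc [symmetric] xpow_mult)
    then show "(\<lambda>I. f * top_form (r + h) I + xpow Theta 2 * pdiff Theta (top_form (r + h) I)) = top_form (theta_op (r + h))"
      by (auto simp: top_form_def theta_op_def pdiff_eq_ldiff ldiff_mult ldiff_tvol algebra_simps)
    have "theta_op (r + h) - theta_op h = theta_op r"
      by (simp add: theta_op_def algebra_simps)
    then show "theta_op (r + h) - theta_op h \<in> Rel"
      using r by (simp add: theta_op_Rel)
  qed
  then show ?thesis
    by (simp add: GM_nabla_theta_def GM_smult)
qed

lemma GM_nabla_q_cls: "GM_nabla_q n (cls h) = cls (- xpow Theta (-1) * B h)"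
proof -
  have "GM_lift n (\<lambda>\<omega> I. \<theta> * (q * pdiff Q (\<omega> I)) - q * pdiff Q f * \<omega> I) (cls h) = cls (- B h)"
    unfolding GM_lift_def
  proof (rule Union_cosets)
    fix r assume r: "r \<in> Rel"
    show "(\<lambda>I. \<theta> * (q * pdiff Q (top_form (r + h) I)) - q * pdiff Q f * top_form (r + h) I) = top_form (- B (r + h))"
      by (auto simp: top_form_def B_def twisted_def ldiff_def [symmetric] ldiff_mult ldiff_tvol algebra_simps)
    show "- B (r + h) - - B h \<in> Rel"
      using B_Rel [OF r] by (simp add: B_add Rel_uminus)
  qed
  then show ?thesis
    by (simp add: GM_nabla_q_def GM_smult)
qed

section \<open>The cyclic vector and its quantum differential equation\<close>

text \<open>The images of the basis \<open>b\<^sub>i\<close>.  The last one is corrected because \<open>b \<circ> b\<^sub>n\<^sub>-\<^sub>2 = b\<^sub>n\<^sub>-\<^sub>1 + 2 q b\<^sub>0\<close>.\<close>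

definition beta :: "nat \<Rightarrow> laurent" where
  "beta i = (if i = n - 1 then (B ^^ (n - 1)) 1 - 2 * q else (B ^^ i) 1)"

definition uexp :: "nat set \<Rightarrow> (nat \<Rightarrow> int) \<Rightarrow> (var \<Rightarrow>\<^sub>0 int)" where
  "uexp A a = (\<Sum>i\<in>A. Poly_Mapping.single (U i) (a i))"

lemma lookup_uexp: "finite A \<Longrightarrow>
    Poly_Mapping.lookup (uexp A a) v = (case v of U i \<Rightarrow> if i \<in> A then a i else 0 | _ \<Rightarrow> 0)"
  by (auto simp: uexp_def lookup_sum lookup_single when_def split: var.split)

lemma prod_xpow: "(\<Prod>i\<in>A. xpow (U i) (a i)) = Poly_Mapping.single (uexp A a) 1"
  by (induction A rule: infinite_finite_induct) (simp_all add: uexp_def xpow_def mult_single)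

text \<open>Dividing \<open>u\<^sub>n\<^sub>-\<^sub>1\<close> by \<open>q\<close> makes the monomials homogeneous of degree zero in these two variables together.\<close>

definition xexp :: "(nat \<Rightarrow> int) \<Rightarrow> int \<Rightarrow> (var \<Rightarrow>\<^sub>0 int)" where
  "xexp a b = uexp {1..n-2} a + Poly_Mapping.single (U (n-1)) b - Poly_Mapping.single Q b"

lemma lookup_xexp: "Poly_Mapping.lookup (xexp a b) v = (case v of
    U i \<Rightarrow> if i \<in> {1..n-2} then a i else if i = n - 1 then b else 0 | Q \<Rightarrow> - b | Theta \<Rightarrow> 0)"
proof -
  have "n - 1 \<notin> {1..n-2}"
    using n_ge_3 by auto
  then show ?thesis
    by (auto simp: xexp_def lookup_add lookup_minus lookup_uexp lookup_single when_def split: var.split)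
qed

lemma tvol_single: "tvol = Poly_Mapping.single (uexp {1..n-1} (\<lambda>_. -1)) 1"
  by (simp add: tvol_def prod_xpow)

definition X :: "(nat \<Rightarrow> int) \<Rightarrow> int \<Rightarrow> laurent" where
  "X a b = Poly_Mapping.single (xexp a b) 1"

lemma X_cong: assumes "\<And>i. i \<in> {1..n-2} \<Longrightarrow> a i = a' i" shows "X a b = X a' b"
proof -
  have "xexp a b = xexp a' b"
    by (rule poly_mapping_eqI) (use assms in \<open>auto simp: lookup_xexp split: var.split\<close>)
  then show ?thesis by (simp add: X_def)
qed

lemma X_in_L [simp]: "X a b \<in> L"
proof -
  have "Poly_Mapping.keys (xexp a b) \<subseteq> U ` {1..n-1} \<union> {Q, Theta}"
  proof
    fix v assume "v \<in> Poly_Mapping.keys (xexp a b)"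
    then have "Poly_Mapping.lookup (xexp a b) v \<noteq> 0"
      by (simp add: in_keys_iff)
    with n_ge_3 show "v \<in> U ` {1..n-1} \<union> {Q, Theta}"
      by (cases v) (auto simp: lookup_xexp split: if_splits)
  qed
  then show ?thesis
    by (simp add: X_def L_def laurent_in_single)
qed

lemma X_0: "X (\<lambda>_. 0) 0 = 1"
proof -
  have "xexp (\<lambda>_. 0) 0 = 0"
    by (rule poly_mapping_eqI) (auto simp: lookup_xexp split: var.split)
  then show ?thesis by (simp add: X_def)
qed

lemma of_int_mult_laurent: "of_int k * Poly_Mapping.single e c = Poly_Mapping.single e (of_int k * c :: complex)"
  by (subst single_of_int [symmetric]) (simp add: mult_single del: single_of_int)

lemma ldiff_X: "i \<in> {1..n-2} \<Longrightarrow> ldiff (U i) (X a b) = of_int (a i) * X a b"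
    "ldiff (U (n-1)) (X a b) = of_int b * X a b" "ldiff Q (X a b) = - of_int b * X a b"
  using n_ge_3 by (auto simp: X_def ldiff_single lookup_xexp of_int_mult_laurent single_uminus)

lemma U_mult_X: "i \<in> {1..n-2} \<Longrightarrow> xpow (U i) 1 * X a b = X (a(i := a i + 1)) b"
  unfolding X_def xpow_def mult_single
  by (intro arg_cong2 [where f = Poly_Mapping.single] poly_mapping_eqI)
    (auto simp: lookup_xexp lookup_add lookup_single when_def split: var.split)

abbreviation dec :: "(nat \<Rightarrow> int) \<Rightarrow> nat \<Rightarrow> int" where
  "dec a \<equiv> \<lambda>i. a i - 1"

text \<open>Combined, these identities evaluate the three monomials of \<open>F\<close> on \<open>X a b\<close>.\<close>

lemma tvol_mult_X: "u * (tvol * X a b) = X (dec a) b" "q * (tvol * X a b) = X (dec a) (b - 1)"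
    "u * X a b = q * X a (b + 1)"
  unfolding X_def xpow_def mult_single tvol_single using n_ge_3
  by (intro arg_cong2 [where f = Poly_Mapping.single] poly_mapping_eqI,
    auto simp: lookup_xexp lookup_uexp lookup_add lookup_single when_def split: var.split)+

lemma B_X: "B (X a b) = of_int b * \<theta> * X a b + 2 * q * (X (dec a) b + X (dec a) (b - 1))"
proof -
  have "B (X a b) = of_int b * \<theta> * X a b + 2 * q * (u * (tvol * X a b) + q * (tvol * X a b))"
    by (simp add: B_def twisted_def ldiff_X ldiff_potential_Q algebra_simps)
  then show ?thesis by (simp only: tvol_mult_X)
qed

text \<open>Modulo the relation for \<open>u\<^sub>n\<^sub>-\<^sub>1\<close>, the operator \<open>B\<close> is multiplication by \<open>F\<close>, up to the total
  derivative in \<open>u\<^sub>n\<^sub>-\<^sub>1\<close> and \<open>q\<close>, which kills the monomials \<open>X a b\<close>.  The relation for \<open>u\<^sub>i\<close> exchanges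
  multiplication by \<open>F + a\<^sub>i \<theta>\<close> for multiplication by \<open>u\<^sub>i\<close>.\<close>

lemma U_relation:
  assumes "i \<in> {1..n-2}"
  shows "X (a(i := a i + 1)) b - (B (X a b) + of_int (a i) * \<theta> * X a b) \<in> Rel"
proof -
  have "F * X a b = ldiff (U (n-1)) f * X a b + ldiff Q f * X a b"
    by (simp add: ldiff_potential_uQ [symmetric] algebra_simps)
  then have "X (a(i := a i + 1)) b - (B (X a b) + of_int (a i) * \<theta> * X a b)
      = - twisted (U i) (X a b) - twisted (U (n-1)) (X a b)"
    unfolding U_mult_X [OF assms, symmetric]
    by (simp add: B_def twisted_def ldiff_X ldiff_X(1) [OF assms] ldiff_potential_U [OF assms] algebra_simps)
  also have "\<dots> \<in> Rel"
    using assms n_ge_3 by (intro Rel_diff Rel_uminus twisted_in_Rel) auto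
  finally show ?thesis .
qed

lemma u_relation: "B (X a b) + of_int b * \<theta> * X a b - 2 * q * (X (dec a) (b + 1) + X (dec a) b) \<in> Rel"
proof -
  have "twisted (U (n-1)) (X a b)
      = of_int b * \<theta> * X a b - u * (u * (tvol * X a b)) + q * (q * (tvol * X a b))"
    by (simp add: twisted_def ldiff_X ldiff_potential_u power2_eq_square algebra_simps)
  also have "\<dots> = of_int b * \<theta> * X a b - q * X (dec a) (b + 1) + q * X (dec a) (b - 1)"
    by (simp only: tvol_mult_X)
  finally have *: "twisted (U (n-1)) (X a b)
      = of_int b * \<theta> * X a b - q * X (dec a) (b + 1) + q * X (dec a) (b - 1)" .
  have "B (X a b) + of_int b * \<theta> * X a b - 2 * q * (X (dec a) (b + 1) + X (dec a) b)
      = 2 * twisted (U (n-1)) (X a b)"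
    unfolding * B_X by (simp add: algebra_simps)
  also have "\<dots> \<in> Rel"
    using n_ge_3 by (intro Rel_base_mult twisted_in_Rel) (auto simp: base_iff)
  finally show ?thesis .
qed

text \<open>\<open>B_X\<close> for \<open>b + 1\<close> and \<open>u_relation\<close> for \<open>b\<close> involve the same two monomials with lowered exponents.\<close>

lemma b_shift_relation:
  "(B (X a (b + 1)) - of_int (b + 1) * \<theta> * X a (b + 1)) - (B (X a b) + of_int b * \<theta> * X a b) \<in> Rel"
proof -
  have "(B (X a (b + 1)) - of_int (b + 1) * \<theta> * X a (b + 1)) - (B (X a b) + of_int b * \<theta> * X a b)
      = - (B (X a b) + of_int b * \<theta> * X a b - 2 * q * (X (dec a) (b + 1) + X (dec a) b))"
    using B_X [of a "b + 1"] by (simp add: algebra_simps)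
  then show ?thesis
    using Rel_uminus [OF u_relation] by simp
qed

lemma B_pow_one: "m \<le> n - 2 \<Longrightarrow> X (\<lambda>i. if i \<le> m then 1 else 0) 0 - (B ^^ m) 1 \<in> Rel"
proof (induction m)
  case 0
  have "X (\<lambda>i. if i \<le> 0 then 1 else 0) 0 = 1"
    unfolding X_0 [symmetric] by (rule X_cong) auto
  then show ?case by simp
next
  case (Suc m)
  let ?a = "\<lambda>i. if i \<le> m then 1 else 0 :: int"
  have "?a(Suc m := ?a (Suc m) + 1) = (\<lambda>i. if i \<le> Suc m then 1 else 0)"
    by auto
  moreover have "X (?a(Suc m := ?a (Suc m) + 1)) 0 - (B (X ?a 0) + of_int (?a (Suc m)) * \<theta> * X ?a 0) \<in> Rel"
    using Suc.prems by (intro U_relation) auto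
  ultimately have "X (\<lambda>i. if i \<le> Suc m then 1 else 0) 0 - B (X ?a 0) \<in> Rel"
    by simp
  moreover have "B (X ?a 0 - (B ^^ m) 1) \<in> Rel"
    using Suc by (intro B_Rel) auto
  ultimately have "(X (\<lambda>i. if i \<le> Suc m then 1 else 0) 0 - B (X ?a 0)) + B (X ?a 0 - (B ^^ m) 1) \<in> Rel"
    by (rule Rel_add)
  then show ?case
    by (simp add: B_diff)
qed

text \<open>By \<open>B_pow_one\<close>, \<open>B\<^bsup>n-2\<^esup> 1\<close> is the class of \<open>u\<^sub>1 \<dots> u\<^sub>n\<^sub>-\<^sub>2\<close>, whose image under \<open>B\<close> is \<open>2 q (1 + Y)\<close> with
  \<open>Y = X 0 (-1)\<close>.  The shift relation \<open>(B - \<theta>) Y = B 1\<close> eliminates \<open>Y\<close> after one more application of \<open>B\<close>.\<close>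

lemma quantum_differential_equation: "(B ^^ n) 1 - 2 * q * (2 * B 1 - \<theta>) \<in> Rel"
proof -
  let ?Y = "X (\<lambda>_. 0) (-1)"
  have "X (\<lambda>i. if i \<le> n - 2 then 1 else 0) 0 = X (\<lambda>_. 1) 0"
    by (rule X_cong) auto
  then have "B (B (X (\<lambda>_. 1) 0 - (B ^^ (n - 2)) 1)) \<in> Rel"
    using B_pow_one [of "n - 2"] by (intro B_Rel) simp
  moreover have "(B ^^ n) 1 = B (B ((B ^^ (n - 2)) 1))"
  proof -
    have "n = Suc (Suc (n - 2))" using n_ge_3 by simp
    then show ?thesis by (metis funpow_simps_right(2) funpow_swap1 comp_apply funpow.simps(2))
  qed
  moreover have "B (B (X (\<lambda>_. 1) 0)) = 2 * q * (B 1 + B ?Y) - 2 * q * \<theta> * (1 + ?Y)"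
    using B_add [of 1 1] by (simp add: B_X X_0 B_mult B_add ldiff_mult ldiff_xpow algebra_simps)
  moreover have "2 * q * (B 1 - (B ?Y - \<theta> * ?Y)) \<in> Rel"
    using b_shift_relation [of "\<lambda>_. 0" "-1"] by (intro Rel_base_mult) (simp_all add: base_iff X_0)
  ultimately have "- B (B (X (\<lambda>_. 1) 0 - (B ^^ (n - 2)) 1)) - 2 * q * (B 1 - (B ?Y - \<theta> * ?Y)) \<in> Rel"
    using Rel_diff Rel_uminus by blast
  moreover have "- B (B (X (\<lambda>_. 1) 0 - (B ^^ (n - 2)) 1)) - 2 * q * (B 1 - (B ?Y - \<theta> * ?Y))
    = (B ^^ n) 1 - 2 * q * (2 * B 1 - \<theta>)"
    by (simp add: B_diff \<open>(B ^^ n) 1 = _\<close> \<open>B (B (X (\<lambda>_. 1) 0)) = _\<close> algebra_simps)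
  ultimately show ?thesis by simp
qed

lemma bvec_sum: "i < n \<Longrightarrow> (\<Sum>j<n. bvec i j * p j) = p i"
proof -
  assume "i < n"
  have "(\<Sum>j<n. bvec i j * p j) = (\<Sum>j<n. if j = i then p i else 0)"
    by (rule sum.cong) (auto simp: bvec_def)
  with \<open>i < n\<close> show ?thesis by simp
qed

lemma beta_in_L [simp]: "beta i \<in> L"
proof -
  have "(B ^^ i) 1 \<in> L" for i
    by (induction i) auto
  then show ?thesis by (simp add: beta_def)
qed

lemma beta_simps: "i \<le> n - 2 \<Longrightarrow> beta i = (B ^^ i) 1" "beta 0 = 1" "beta 1 = B 1"
    "beta (n - 1) = (B ^^ (n - 1)) 1 - 2 * q"
  using n_ge_3 by (auto simp: beta_def One_nat_def)

lemma B_beta: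
  assumes "i < n"
  shows "B (beta i) - (\<Sum>j<n. bmult n i j * beta j) \<in> Rel"
proof -
  consider "i \<le> n - 3" | "i = n - 2" | "i = n - 1"
    using assms by linarith
  then show ?thesis
  proof cases
    case 1
    then have "beta (Suc i) = B (beta i)" "i + 1 < n"
      using n_ge_3 by (auto simp: beta_def)
    then have "beta (i + 1) = B (beta i)" "i + 1 < n"
      by (simp_all add: Suc_eq_plus1)
    then show ?thesis
      using 1 by (simp add: bmult_def bvec_sum)
  next
    case 2
    then have i: "\<not> i \<le> n - 3" "n - 1 < n" "0 < n" "n - 1 = Suc i"
      using n_ge_3 by auto
    then have "(B ^^ (n - 1)) 1 = B ((B ^^ i) 1)"
      by simp
    then have "beta (n - 1) + 2 * q * beta 0 = B (beta i)"
      using 2 by (simp add: beta_simps)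
    moreover from i have "(\<Sum>j<n. bmult n i j * beta j) = beta (n - 1) + 2 * q * beta 0"
      using 2 by (simp add: bmult_def distrib_right sum.distrib bvec_sum mult.assoc sum_distrib_left [symmetric])
    ultimately show ?thesis by simp
  next
    case 3
    then have i: "\<not> i \<le> n - 3" "i \<noteq> n - 2" "1 < n" "n = Suc (n - 1)"
      using n_ge_3 by auto
    then have "(\<Sum>j<n. bmult n i j * beta j) = 2 * q * B 1"
      by (simp add: bmult_def bvec_sum mult.assoc sum_distrib_left [symmetric] beta_simps)
    moreover have "B (beta i) = (B ^^ n) 1 - 2 * q * B 1 + 2 * q * \<theta>"
    proof -
      have "B ((B ^^ (n - 1)) 1) = (B ^^ n) 1"
        using i(4) by (metis comp_apply funpow.simps(2))
      then show ?thesis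
        using B_mult [of "2 * q" 1] by (simp add: 3 beta_simps B_diff ldiff_mult ldiff_xpow algebra_simps)
    qed
    ultimately have "B (beta i) - (\<Sum>j<n. bmult n i j * beta j) = (B ^^ n) 1 - 2 * q * (2 * B 1 - \<theta>)"
      by (simp add: algebra_simps)
    then show ?thesis
      using quantum_differential_equation by simp
  qed
qed

section \<open>Homogeneity\<close>

text \<open>The grading has \<open>deg \<theta> = deg u\<^sub>i = 1\<close> for \<open>i \<le> n - 2\<close> and \<open>deg u\<^sub>n\<^sub>-\<^sub>1 = deg q = n - 1\<close>.\<close>

definition euler :: "laurent \<Rightarrow> laurent" where
  "euler h = ldiff Theta h + (\<Sum>i=1..n-2. ldiff (U i) h) + of_nat (n - 1) * (ldiff (U (n-1)) h + ldiff Q h)"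

lemma euler_potential: "euler f = f"
proof -
  have "euler f = (\<Sum>i=1..n-2. ldiff (U i) f) + of_nat (n - 1) * F"
    by (simp add: euler_def ldiff_potential_Theta ldiff_potential_uQ)
  moreover have "(\<Sum>i=1..n-2. ldiff (U i) f) = (\<Sum>i=1..n-2. xpow (U i) 1) - of_nat (n - 2) * F"
    by (simp add: ldiff_potential_U sum_subtractf)
  moreover have "of_nat (n - 1) = (of_nat (n - 2) + 1 :: laurent)"
    using n_ge_3 by (metis One_nat_def Suc_1 Suc_diff_Suc Suc_le_lessD add.commute
        numeral_3_eq_3 of_nat_Suc Suc_leD)
  ultimately have "euler f = (\<Sum>i=1..n-2. xpow (U i) 1) + F"
    by (simp add: algebra_simps)
  then show ?thesis
    by (simp only: potential_eq)
qed

lemma euler_mult: "euler (a * b) = euler a * b + a * euler b"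
  by (simp add: euler_def ldiff_mult sum.distrib sum_distrib_left sum_distrib_right algebra_simps)

lemma euler_diff: "euler (a - b) = euler a - euler b"
  by (simp add: euler_def sum_subtractf algebra_simps)

lemma euler_uminus: "euler (- a) = - euler a"
  using euler_diff [of 0 a] euler_diff [of 0 0] by simp

lemma euler_ldiff: "euler (ldiff v h) = ldiff v (euler h)"
  by (simp add: euler_def ldiff_sum ldiff_mult ldiff_commute [of v])

lemma euler_theta: "euler \<theta> = \<theta>" and euler_q: "euler q = of_nat (n - 1) * q"
  and euler_1: "euler 1 = 0" and euler_2: "euler 2 = 0"
  by (simp_all add: euler_def ldiff_xpow)

lemma euler_B: "euler (B h) = B (euler h) + B h"
proof -
  have "euler (ldiff Q f) = ldiff Q f"
    by (simp add: euler_ldiff euler_potential)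
  then show ?thesis
    by (simp add: B_def twisted_def euler_uminus euler_diff euler_mult euler_theta euler_ldiff algebra_simps)
qed

lemma euler_beta: "euler (beta i) = of_nat i * beta i"
proof -
  have *: "euler ((B ^^ i) 1) = of_nat i * (B ^^ i) 1" for i
  proof (induction i)
    case (Suc i)
    then show ?case
      by (simp add: euler_B B_mult algebra_simps)
  qed (simp add: euler_1)
  then show ?thesis
    by (simp add: beta_def euler_diff euler_mult euler_2 euler_q algebra_simps)
qed

text \<open>Write \<open>f\<close> as its own Euler derivative.  The part along \<open>u\<^sub>1, \<dots>, u\<^sub>n\<^sub>-\<^sub>1\<close> is replaced by derivatives of \<open>h\<close>
  with the help of the relations, and the part along \<open>q\<close> with the help of \<open>B\<close>.\<close>

lemma theta_op_euler:
  assumes "h \<in> L"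
  shows "theta_op h - (of_nat (n - 1) * B h + \<theta> * euler h) \<in> Rel"
proof -
  let ?m = "of_nat (n - 1) :: laurent"
  have "f * h = (\<Sum>i=1..n-2. ldiff (U i) f * h) + ?m * (ldiff (U (n-1)) f * h + ldiff Q f * h)"
    using euler_potential
    by (simp add: euler_def ldiff_potential_Theta sum_distrib_right [symmetric] distrib_right [symmetric]
        mult.assoc [symmetric])
  then have "theta_op h - (?m * B h + \<theta> * euler h)
      = - (\<Sum>i=1..n-2. twisted (U i) h) - ?m * twisted (U (n-1)) h"
    by (simp add: theta_op_def euler_def B_def twisted_def sum_subtractf sum_distrib_left algebra_simps)
  also have "\<dots> \<in> Rel"
    using assms n_ge_3
    by (intro Rel_diff Rel_uminus Rel_sum Rel_base_mult twisted_in_Rel) (auto simp: base_iff)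
  finally show ?thesis .
qed

section \<open>Generation\<close>

definition beta_span :: "laurent set" where
  "beta_span = {(\<Sum>i<n. c i * beta i) + r | c r. (\<forall>i<n. c i \<in> base) \<and> r \<in> Rel}"

lemma base_closed [simp]: "a \<in> base \<Longrightarrow> b \<in> base \<Longrightarrow> a + b \<in> base"
    "a \<in> base \<Longrightarrow> - a \<in> base" "a \<in> base \<Longrightarrow> b \<in> base \<Longrightarrow> a - b \<in> base"
    "a \<in> base \<Longrightarrow> b \<in> base \<Longrightarrow> a * b \<in> base" "0 \<in> base" "1 \<in> base" "of_int k \<in> base"
    "of_nat m \<in> base" "numeral w \<in> base" "Poly_Mapping.single 0 z \<in> base"
    "a \<in> base \<Longrightarrow> ldiff v a \<in> base" "a \<in> base \<Longrightarrow> pdiff v a \<in> base"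
  by (simp_all add: base_iff laurent_in_single)

lemma base_sum [simp]: "(\<And>i. i \<in> I \<Longrightarrow> a i \<in> base) \<Longrightarrow> (\<Sum>i\<in>I. a i) \<in> base"
  by (simp add: base_iff)

lemma beta_spanI: "(\<And>i. i < n \<Longrightarrow> c i \<in> base) \<Longrightarrow> r \<in> Rel \<Longrightarrow> (\<Sum>i<n. c i * beta i) + r \<in> beta_span"
  unfolding beta_span_def by blast

lemma beta_span_add: assumes "x \<in> beta_span" "y \<in> beta_span" shows "x + y \<in> beta_span"
proof -
  obtain c r d s where "\<forall>i<n. c i \<in> base" "r \<in> Rel" "\<forall>i<n. d i \<in> base" "s \<in> Rel"
    and "x = (\<Sum>i<n. c i * beta i) + r" "y = (\<Sum>i<n. d i * beta i) + s"
    using assms unfolding beta_span_def by blast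
  then show ?thesis
    using beta_spanI [of "\<lambda>i. c i + d i" "r + s"] by (simp add: Rel_add sum.distrib algebra_simps)
qed

lemma beta_span_mult: assumes "a \<in> base" "x \<in> beta_span" shows "a * x \<in> beta_span"
proof -
  obtain c r where "\<forall>i<n. c i \<in> base" "r \<in> Rel" "x = (\<Sum>i<n. c i * beta i) + r"
    using assms unfolding beta_span_def by blast
  then show ?thesis
    using beta_spanI [of "\<lambda>i. a * c i" "a * r"] assms(1)
    by (simp add: Rel_base_mult sum_distrib_left algebra_simps)
qed

lemma beta_span_Rel: "r \<in> Rel \<Longrightarrow> r \<in> beta_span"
  using beta_spanI [of "\<lambda>_. 0" r] by simp

lemma beta_span_uminus: "x \<in> beta_span \<Longrightarrow> - x \<in> beta_span"
  using beta_span_mult [of "-1" x] by simp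

lemma beta_span_diff: "x \<in> beta_span \<Longrightarrow> y \<in> beta_span \<Longrightarrow> x - y \<in> beta_span"
  using beta_span_add [of x "- y"] beta_span_uminus by simp

lemma beta_span_sum: "(\<And>i. i \<in> I \<Longrightarrow> x i \<in> beta_span) \<Longrightarrow> (\<Sum>i\<in>I. x i) \<in> beta_span"
  by (induction I rule: infinite_finite_induct) (auto intro: beta_span_add beta_span_Rel)

lemma beta_span_cong: "x - y \<in> Rel \<Longrightarrow> x \<in> beta_span \<longleftrightarrow> y \<in> beta_span"
  using beta_span_add [of "x - y" y] beta_span_diff [of x "x - y"] beta_span_Rel [of "x - y"] by auto

lemma beta_in_beta_span: assumes "i < n" shows "beta i \<in> beta_span"
proof -
  have "(\<Sum>j<n. (if j = i then 1 else 0) * beta j) = (\<Sum>j<n. if j = i then beta i else 0)"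
    by (rule sum.cong) auto
  then show ?thesis
    using beta_spanI [of "\<lambda>j. if j = i then 1 else 0" 0] assms by simp
qed

lemma bvec_base [simp]: "bvec i j \<in> base"
  by (simp add: bvec_def)

lemma bmult_base [simp]: "bmult n i j \<in> base"
  by (simp add: bmult_def)

lemma B_beta_span: assumes "x \<in> beta_span" shows "B x \<in> beta_span"
proof -
  obtain c r where c: "\<forall>i<n. c i \<in> base" and "r \<in> Rel" and x: "x = (\<Sum>i<n. c i * beta i) + r"
    using assms unfolding beta_span_def by blast
  have "B (beta i) \<in> beta_span" if "i < n" for i
    using beta_span_cong [OF B_beta [OF that]] by (auto intro!: beta_span_sum beta_span_mult beta_in_beta_span)
  then have "B (c i * beta i) \<in> beta_span" if "i < n" for i
    using c that unfolding B_mult by (intro beta_span_diff beta_span_mult beta_in_beta_span) auto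
  then show ?thesis
    using beta_span_Rel [OF B_Rel [OF \<open>r \<in> Rel\<close>]] unfolding x B_add B_sum by (intro beta_span_add beta_span_sum) auto
qed

lemma beta_span_int_cancel: assumes "of_int k * x \<in> beta_span" "k \<noteq> 0" shows "x \<in> beta_span"
proof -
  let ?c = "Poly_Mapping.single 0 (inverse (of_int k)) :: laurent"
  have "of_int k * ?c = 1"
    using assms(2) by (simp add: of_int_mult_laurent)
  moreover have "?c * (of_int k * x) \<in> beta_span"
    using assms(1) by (rule beta_span_mult [rotated]) simp
  moreover have "?c * (of_int k * x) = (of_int k * ?c) * x"
    by (simp only: mult_ac)
  ultimately show ?thesis
    by simp
qed

lemma beta_span_cancel: "2 * q * x \<in> beta_span \<Longrightarrow> x \<in> beta_span" "\<theta> * x \<in> beta_span \<Longrightarrow> x \<in> beta_span"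
proof -
  assume "2 * q * x \<in> beta_span"
  then have "of_int 2 * x \<in> beta_span"
    using beta_span_mult [of "xpow Q (-1)" "2 * q * x"]
    by (simp add: mult.left_commute [of _ 2] xpow_cancel mult.assoc)
  then show "x \<in> beta_span"
    by (rule beta_span_int_cancel) simp
next
  assume "\<theta> * x \<in> beta_span"
  then show "x \<in> beta_span"
    using beta_span_mult [of "xpow Theta (-1)" "\<theta> * x"] by (simp add: xpow_cancel)
qed

lemma X_up: "X a b \<in> beta_span \<Longrightarrow> i \<in> {1..n-2} \<Longrightarrow> X (a(i := a i + 1)) b \<in> beta_span"
  using beta_span_cong [OF U_relation [of i a b]]
  by (auto intro!: beta_span_add beta_span_mult B_beta_span simp: mult.assoc)

lemma X_up_set:
  assumes "X a b \<in> beta_span" "A \<subseteq> {1..n-2}"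
  shows "X (\<lambda>i. if i \<in> A then a i + 1 else a i) b \<in> beta_span"
proof -
  have "finite A"
    using assms(2) finite_subset by blast
  then show ?thesis
    using assms(2)
  proof (induction A)
    case (insert k A)
    let ?a = "\<lambda>i. if i \<in> A then a i + 1 else a i"
    have "(\<lambda>i. if i \<in> insert k A then a i + 1 else a i) = ?a(k := ?a k + 1)"
      using insert.hyps by auto
    then show ?case
      using X_up [of ?a b k] insert by simp
  qed (use assms(1) in simp)
qed

text \<open>After raising all exponents, \<open>B_X\<close> and \<open>u_relation\<close> give back the sum of \<open>X a b\<close> and a neighbour in \<open>b\<close>.\<close>

lemma X_b_closed:
  assumes "X a b \<in> beta_span" shows "X a (b - 1) \<in> beta_span" "X a (b + 1) \<in> beta_span"
proof -
  let ?a = "\<lambda>i. a i + 1"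
  have "X (\<lambda>i. if i \<in> {1..n-2} then a i + 1 else a i) b = X ?a b"
    by (rule X_cong) auto
  then have a: "X ?a b \<in> beta_span"
    using X_up_set [OF assms, of "{1..n-2}"] by simp
  have "X a b + X a (b - 1) \<in> beta_span"
  proof (rule beta_span_cancel)
    have "2 * q * (X a b + X a (b - 1)) = B (X ?a b) - of_int b * \<theta> * X ?a b"
      using B_X [of ?a b] by simp
    also have "\<dots> \<in> beta_span"
      using a by (intro beta_span_diff B_beta_span beta_span_mult) auto
    finally show "2 * q * (X a b + X a (b - 1)) \<in> beta_span" .
  qed
  from beta_span_diff [OF this assms] show "X a (b - 1) \<in> beta_span" by simp
  have "X a (b + 1) + X a b \<in> beta_span"
  proof (rule beta_span_cancel)
    have "B (X ?a b) + of_int b * \<theta> * X ?a b \<in> beta_span"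
      using a by (intro beta_span_add B_beta_span beta_span_mult) auto
    then show "2 * q * (X a (b + 1) + X a b) \<in> beta_span"
      using beta_span_cong [OF u_relation [of ?a b]] by simp
  qed
  from beta_span_diff [OF this assms] show "X a (b + 1) \<in> beta_span" by simp
qed

lemma X_b_all: assumes "X a 0 \<in> beta_span" shows "X a b \<in> beta_span"
  by (induction b rule: int_induct [of _ 0]) (use assms X_b_closed in auto)

text \<open>Lowering an exponent cannot simply undo raising it, because \<open>B + a \<theta>\<close> is not invertible in general.
  But \<open>B_X\<close> makes \<open>X c 1\<close> and \<open>- X c 0\<close> congruent modulo \<open>beta_span\<close>, and then \<open>b_shift_relation\<close> reads
  \<open>2 B (X c 0) = \<theta> (X c 0)\<close>.\<close>

lemma X_half:
  assumes "\<And>b. X (\<lambda>i. c i + 1) b \<in> beta_span"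
  shows "2 * B (X c 0) - \<theta> * X c 0 \<in> beta_span"
proof -
  have *: "X c 1 + X c 0 \<in> beta_span"
  proof (rule beta_span_cancel)
    have "2 * q * (X c 1 + X c 0) = B (X (\<lambda>i. c i + 1) 1) - \<theta> * X (\<lambda>i. c i + 1) 1"
      using B_X [of "\<lambda>i. c i + 1" 1] by simp
    also have "\<dots> \<in> beta_span"
      using assms by (intro beta_span_diff B_beta_span beta_span_mult) auto
    finally show "2 * q * (X c 1 + X c 0) \<in> beta_span" .
  qed
  have "B (X c 1 + X c 0) - \<theta> * (X c 1 + X c 0) \<in> beta_span"
    using * by (intro beta_span_diff B_beta_span beta_span_mult) auto
  moreover have "(B (X c 1) - \<theta> * X c 1) - B (X c 0) \<in> beta_span"
    using beta_span_Rel [OF b_shift_relation [of c 0]] by simp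
  ultimately have "(B (X c 1 + X c 0) - \<theta> * (X c 1 + X c 0)) - ((B (X c 1) - \<theta> * X c 1) - B (X c 0)) \<in> beta_span"
    by (rule beta_span_diff)
  then show ?thesis
    by (simp add: B_add algebra_simps)
qed

text \<open>If \<open>c\<close> has \<open>i\<close>-th exponent \<open>c\<^sub>i\<close>, raising it back applies \<open>B + c\<^sub>i \<theta>\<close>, which by \<open>X_half\<close> is
  multiplication by \<open>(c\<^sub>i + 1 / 2) \<theta>\<close>; the factor is a unit since \<open>2 c\<^sub>i + 1\<close> is odd.\<close>

lemma X_down:
  assumes "\<And>b. X a b \<in> beta_span" "i \<in> {1..n-2}"
  shows "X (a(i := a i - 1)) b \<in> beta_span"
proof (rule X_b_all)
  define c where "c = a(i := a i - 1)"
  have "X (\<lambda>k. c k + 1) b \<in> beta_span" for b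
  proof -
    have "X (\<lambda>k. c k + 1) b = X (\<lambda>k. if k \<in> {1..n-2} - {i} then a k + 1 else a k) b"
      by (rule X_cong) (auto simp: c_def)
    then show ?thesis
      using X_up_set [OF assms(1), of "{1..n-2} - {i}"] by auto
  qed
  then have half: "2 * B (X c 0) - \<theta> * X c 0 \<in> beta_span"
    by (rule X_half)
  have "c(i := c i + 1) = a"
    by (simp add: c_def)
  then have "B (X c 0) + of_int (c i) * \<theta> * X c 0 \<in> beta_span"
    using beta_span_cong [OF U_relation [OF assms(2), of c 0]] assms(1) by simp
  then have "2 * (B (X c 0) + of_int (c i) * \<theta> * X c 0) - (2 * B (X c 0) - \<theta> * X c 0) \<in> beta_span"
    using half by (rule beta_span_diff [OF beta_span_mult, rotated]) simp
  moreover have "2 * (B (X c 0) + of_int (c i) * \<theta> * X c 0) - (2 * B (X c 0) - \<theta> * X c 0)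
      = of_int (2 * c i + 1) * (\<theta> * X c 0)"
    by (simp add: algebra_simps)
  moreover have "2 * c i + 1 \<noteq> 0"
    by presburger
  ultimately have "\<theta> * X c 0 \<in> beta_span"
    using beta_span_int_cancel [of "2 * c i + 1" "\<theta> * X c 0"] by simp
  then show "X (a(i := a i - 1)) 0 \<in> beta_span"
    unfolding c_def [symmetric] by (rule beta_span_cancel)
qed

lemma X_in_beta_span: "X a b \<in> beta_span"
proof (induction "nat (\<Sum>i=1..n-2. \<bar>a i\<bar>)" arbitrary: a b rule: less_induct)
  case less
  show ?case
  proof (cases "\<exists>i\<in>{1..n-2}. a i \<noteq> 0")
    case False
    then have "X a 0 = beta 0"
      using n_ge_3 X_cong [of a "\<lambda>_. 0" 0] by (simp add: X_0 beta_simps)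
    then show ?thesis
      using X_b_all beta_in_beta_span [of 0] n_ge_3 by simp
  next
    case True
    then obtain i where i: "i \<in> {1..n-2}" "a i \<noteq> 0" by blast
    define a' where "a' = a(i := a i - sgn (a i))"
    have "(\<Sum>k=1..n-2. \<bar>a' k\<bar>) < (\<Sum>k=1..n-2. \<bar>a k\<bar>)"
      by (rule sum_strict_mono_ex1) (use i in \<open>auto simp: a'_def sgn_if\<close>)
    moreover have "0 \<le> (\<Sum>k=1..n-2. \<bar>a' k\<bar>)"
      by (simp add: sum_nonneg)
    ultimately have a': "X a' b \<in> beta_span" for b
      by (intro less) linarith
    have "a = a'(i := a' i + 1) \<or> a = a'(i := a' i - 1)"
      using i(2) by (auto simp: a'_def sgn_if)
    then show ?thesis
      using X_up [OF a' i(1)] X_down [OF a' i(1)] by metis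
  qed
qed

lemma L_subset_beta_span: assumes "h \<in> L" shows "h \<in> beta_span"
proof (rule laurent_induct [of h])
  fix e c assume e: "e \<in> Poly_Mapping.keys h"
  let ?a = "\<lambda>i. Poly_Mapping.lookup e (U i)"
  let ?k = "Poly_Mapping.lookup e Q + Poly_Mapping.lookup e (U (n-1))"
  have "Poly_Mapping.lookup e (U i) = 0" if "i \<notin> {1..n-1}" for i
  proof -
    have "Poly_Mapping.keys e \<subseteq> U ` {1..n-1} \<union> {Q, Theta}"
      using assms e by (simp add: L_def laurent_in_iff)
    then have "U i \<notin> Poly_Mapping.keys e"
      using that by blast
    then show ?thesis by (simp add: in_keys_iff)
  qed
  moreover have "i \<in> {1..n-2} \<or> i = n - 1 \<longleftrightarrow> i \<in> {1..n-1}" "n - 1 \<notin> {1..n-2}" for i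
    using n_ge_3 by auto
  ultimately have "e = Poly_Mapping.single Q ?k + Poly_Mapping.single Theta (Poly_Mapping.lookup e Theta)
      + xexp ?a (?a (n - 1))"
    by (intro poly_mapping_eqI)
      (force simp: lookup_xexp lookup_add lookup_single when_def split: var.split)
  then have "Poly_Mapping.single e c = Poly_Mapping.single 0 c
      * (xpow Q ?k * xpow Theta (Poly_Mapping.lookup e Theta)) * X ?a (?a (n - 1))"
    by (simp add: xpow_def X_def mult_single)
  also have "\<dots> \<in> beta_span"
    by (intro beta_span_mult X_in_beta_span) simp_all
  finally show "Poly_Mapping.single e c \<in> beta_span" .
qed (auto intro: beta_span_Rel beta_span_add)

end

section \<open>Independence of solutions of a hypergeometric recurrence\<close>

text \<open>For these \<open>s\<close>, all integer translates of \<open>s\<close> and \<open>2 s\<close> avoid the poles of the Gamma function.\<close>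

definition non_half :: "complex \<Rightarrow> bool" where
  "non_half s \<longleftrightarrow> (\<forall>k::int. 2 * s \<noteq> of_int k)"

lemma non_half_add_int [simp]: "non_half (s + of_int k) \<longleftrightarrow> non_half s"
proof -
  have "non_half (t + of_int j)" if "non_half t" for t j
    unfolding non_half_def
  proof
    fix l :: int
    show "2 * (t + of_int j) \<noteq> of_int l"
    proof
      assume *: "2 * (t + of_int j) = of_int l"
      have "2 * t = 2 * (t + of_int j) - 2 * of_int j"
        by simp
      also have "\<dots> = of_int (l - 2 * j)"
        unfolding * by simp
      finally have "2 * t = of_int (l - 2 * j)" .
      with that show False unfolding non_half_def by blast
    qed
  qed
  from this [of s k] this [of "s + of_int k" "- k"] show ?thesis by auto
qed

lemma non_half_add [simp]: "non_half (s + 1) \<longleftrightarrow> non_half s" "non_half (s + of_nat m) \<longleftrightarrow> non_half s"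
  using non_half_add_int [of s 1] non_half_add_int [of s "int m"] by simp_all

lemma non_half_diff_int [simp]: "non_half (s - of_int k) \<longleftrightarrow> non_half s"
  using non_half_add_int [of s "- k"] by simp

lemma infinite_non_half: "infinite {s. non_half s}"
proof -
  have "\<i> * of_nat (Suc m) \<in> {s. non_half s}" for m
    by (auto simp: non_half_def complex_eq_iff)
  then have "range (\<lambda>m. \<i> * of_nat (Suc m)) \<subseteq> {s. non_half s}"
    by blast
  moreover have "inj (\<lambda>m. \<i> * of_nat (Suc m))"
    by (rule injI) (simp add: complex_eq_iff)
  ultimately show ?thesis
    using finite_subset range_inj_infinite by blast
qed

text \<open>A relation among the shifts \<open>E (s + k)\<close> whose coefficients are polynomials of degree less than \<open>n\<close>
  is trivial: expressing all terms by the lowest shift \<open>E x\<close>, every other term acquires the factor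
  \<open>x ^ n\<close>, so \<open>x ^ n\<close> divides the lowest coefficient up to the denominators, which are units at \<open>0\<close>.\<close>

lemma shift_recurrence_independent:
  fixes E :: "complex \<Rightarrow> complex" and R :: "int \<Rightarrow> complex poly"
  assumes nz: "\<And>s. non_half s \<Longrightarrow> E s \<noteq> 0"
    and rec: "\<And>s. non_half s \<Longrightarrow> 2 * (2 * s + 1) * E (s + 1) = s ^ n * E s"
    and fin: "finite K" and deg: "\<And>k. k \<in> K \<Longrightarrow> degree (R k) < n"
    and sum_0: "\<And>s. non_half s \<Longrightarrow> (\<Sum>k\<in>K. poly (R k) (s + of_int k) * E (s + of_int k)) = 0"
  shows "\<forall>k\<in>K. R k = 0"
proof (rule ccontr)
  define K' where "K' = {k \<in> K. R k \<noteq> 0}"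
  assume "\<not> ?thesis"
  then have K': "finite K'" "K' \<noteq> {}"
    using fin by (auto simp: K'_def)
  define k0 where "k0 = Min K'"
  define m where "m k = nat (k - k0)" for k
  define M where "M = nat (Max K' - k0)"
  have k0: "k0 \<in> K'"
    using K' by (simp add: k0_def)
  have k0_le: "k0 \<le> k" and m_le: "m k \<le> M" if "k \<in> K'" for k
    using K' that by (auto simp: k0_def m_def M_def intro!: nat_mono diff_right_mono)
  define den num :: "nat \<Rightarrow> complex poly"
    where "den l = [:2 * (2 * of_nat l + 1), 4:]" and "num l = [:of_nat l, 1:] ^ n" for l
  have E_shift: "(\<Prod>l<j. poly (den l) x) * E (x + of_nat j) = (\<Prod>l<j. poly (num l) x) * E x"
    if "non_half x" for x j
  proof (induction j)
    case (Suc j)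
    have "poly (den j) x * E (x + of_nat (Suc j)) = poly (num j) x * E (x + of_nat j)"
      using rec [of "x + of_nat j"] that
      by (simp add: den_def num_def poly_power algebra_simps)
    then have "(\<Prod>l<Suc j. poly (den l) x) * E (x + of_nat (Suc j))
        = poly (num j) x * ((\<Prod>l<j. poly (den l) x) * E (x + of_nat j))"
      by (simp only: prod.lessThan_Suc mult.assoc mult.left_commute)
    also have "\<dots> = poly (num j) x * ((\<Prod>l<j. poly (num l) x) * E x)"
      by (simp only: Suc.IH)
    finally show ?case
      by (simp only: prod.lessThan_Suc mult_ac)
  qed simp
  define D where "D = (\<Prod>l<M. den l)"
  \<comment> \<open>the summand of index \<open>k\<close> at \<open>s = x - k0\<close>, divided by \<open>E x\<close> and multiplied by the common denominator\<close>
  define T where "T k = pcompose (R k) [:of_int (k - k0), 1:] * (\<Prod>l<m k. num l) * (\<Prod>l\<in>{m k..<M}. den l)" for k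
  have T_E: "poly (T k) x * E x = poly D x * (poly (R k) (x + of_int (k - k0)) * E (x + of_int (k - k0)))"
    if "k \<in> K'" "non_half x" for k x
  proof -
    have "(\<Prod>l<M. poly (den l) x) = (\<Prod>l<m k. poly (den l) x) * (\<Prod>l\<in>{m k..<M}. poly (den l) x)"
      using m_le [OF that(1)] prod.atLeastLessThan_concat [of 0 "m k" M "\<lambda>l. poly (den l) x"]
      by (simp add: lessThan_atLeast0)
    moreover have "of_int (k - k0) = (of_nat (m k) :: complex)"
      using k0_le [OF that(1)] by (simp add: m_def)
    ultimately show ?thesis
      using E_shift [OF that(2), of "m k"]
      by (simp add: T_def D_def poly_pcompose poly_prod add.commute mult_ac)
  qed
  have "poly (\<Sum>k\<in>K'. T k) x = 0" if "non_half x" for x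
  proof -
    have "(\<Sum>k\<in>K'. poly (R k) (x + of_int (k - k0)) * E (x + of_int (k - k0)))
        = (\<Sum>k\<in>K. poly (R k) (x - of_int k0 + of_int k) * E (x - of_int k0 + of_int k))"
      unfolding K'_def using fin by (intro sum.mono_neutral_cong_left) (auto simp: algebra_simps)
    also have "\<dots> = 0"
      using that by (intro sum_0) simp
    finally have "(\<Sum>k\<in>K'. poly (T k) x * E x) = 0"
      using that by (simp add: T_E sum_distrib_left [symmetric])
    then show ?thesis
      using nz [OF that] by (simp add: poly_sum sum_distrib_right [symmetric])
  qed
  then have "{s. non_half s} \<subseteq> {x. poly (\<Sum>k\<in>K'. T k) x = 0}"
    by blast
  then have "(\<Sum>k\<in>K'. T k) = 0"
    using poly_roots_finite infinite_non_half finite_subset by blast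
  then have "T k0 = - (\<Sum>k\<in>K' - {k0}. T k)"
    using sum.remove [OF K'(1) k0, of T] k0 K' by (auto simp: eq_neg_iff_add_eq_0)
  moreover have "[:0, 1:] ^ n dvd T k" if "k \<in> K' - {k0}" for k
  proof -
    have "0 < m k"
      using that k0_le [of k] by (auto simp: m_def)
    then have "num 0 dvd (\<Prod>l<m k. num l)"
      by (intro dvd_prodI) auto
    then show ?thesis
      by (auto simp: T_def num_def intro: dvd_mult dvd_mult2)
  qed
  ultimately have "[:- 0, 1:] ^ n dvd T k0"
    by (auto intro: dvd_sum)
  moreover have "T k0 = R k0 * D"
    by (simp add: T_def D_def m_def lessThan_atLeast0 pcompose_idR)
  moreover have "poly D 0 \<noteq> 0"
  proof -
    have "poly (den l) 0 = of_nat (4 * l + 2)" for l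
      by (simp add: den_def algebra_simps)
    then have "poly (den l) 0 \<noteq> 0" for l
      by (simp only: of_nat_eq_0_iff)
    then show ?thesis
      by (simp add: D_def poly_prod)
  qed
  moreover have "R k0 \<noteq> 0" "degree (R k0) < n"
    using k0 K' deg by (auto simp: K'_def)
  ultimately have "n \<le> order 0 (R k0 * D)" "R k0 * D \<noteq> 0" "order 0 D = 0"
    using order_divides [of 0 n "R k0 * D"] by (auto simp: order_0I)
  then have "n \<le> order 0 (R k0)"
    by (simp add: order_mult)
  then show False
    using order_degree [OF \<open>R k0 \<noteq> 0\<close>, of 0] \<open>degree (R k0) < n\<close> by simp
qed

lemma Gamma_shift:
  assumes "non_half s"
  shows "s \<noteq> 0" "Gamma s \<noteq> 0" "Gamma (s + 1) = s * Gamma s" "Gamma (2 * s) \<noteq> 0"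
    "2 * s + 1 \<noteq> 0" "Gamma (2 * (s + 1)) = (2 * s + 1) * (2 * s) * Gamma (2 * s)"
proof -
  have s2: "2 * s + of_int k \<notin> \<int>\<^sub>\<le>\<^sub>0" for k
  proof
    assume "2 * s + of_int k \<in> \<int>\<^sub>\<le>\<^sub>0"
    then obtain l :: int where *: "2 * s + of_int k = of_int l"
      by (elim nonpos_Ints_cases) auto
    have "2 * s = 2 * s + of_int k - of_int k"
      by simp
    also have "\<dots> = of_int (l - k)"
      unfolding * by simp
    finally have "2 * s = of_int (l - k)" .
    with assms show False
      unfolding non_half_def by blast
  qed
  have s1: "s \<notin> \<int>\<^sub>\<le>\<^sub>0"
  proof
    assume "s \<in> \<int>\<^sub>\<le>\<^sub>0"
    then obtain l :: int where "s = of_int l"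
      by (elim nonpos_Ints_cases) auto
    then have "2 * s = of_int (2 * l)" by simp
    with assms show False unfolding non_half_def by blast
  qed
  have "2 * s \<noteq> of_int 0" "2 * s \<noteq> of_int (-1)"
    using assms unfolding non_half_def by blast+
  then show "s \<noteq> 0" "2 * s + 1 \<noteq> 0"
    by (auto simp: eq_neg_iff_add_eq_0)
  show "Gamma s \<noteq> 0" "Gamma (s + 1) = s * Gamma s"
    using s1 by (simp_all add: Gamma_eq_zero_iff Gamma_plus1)
  show "Gamma (2 * s) \<noteq> 0"
    using s2 [of 0] by (simp add: Gamma_eq_zero_iff)
  have "Gamma (2 * s + 1 + 1) = (2 * s + 1) * ((2 * s) * Gamma (2 * s))"
  proof -
    have "2 * s \<notin> \<int>\<^sub>\<le>\<^sub>0" "2 * s + 1 \<notin> \<int>\<^sub>\<le>\<^sub>0"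
      using s2 [of 0] s2 [of 1] by simp_all
    then show ?thesis
      by (simp only: Gamma_plus1 not_False_eq_True)
  qed
  then show "Gamma (2 * (s + 1)) = (2 * s + 1) * (2 * s) * Gamma (2 * s)"
    by (simp add: algebra_simps)
qed

section \<open>Functionals vanishing on the relations\<close>

context quadric
begin

text \<open>Where it converges, this is the integral over positive reals of \<open>exp (- f) u\<^sub>1\<^bsup>a\<^sub>1\<^esup> \<dots> u\<^sub>n\<^sub>-\<^sub>1\<^bsup>b\<^esup> q\<^bsup>s-b\<^esup>\<close> with
  respect to \<open>dq / q\<close> and all \<open>du\<^sub>i / u\<^sub>i\<close>: substituting \<open>q = t u\<^sub>n\<^sub>-\<^sub>1\<close> and integrating over \<open>u\<^sub>n\<^sub>-\<^sub>1\<close> gives \<open>Gamma s\<close>,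
  then a Beta integral in \<open>t\<close> and Gamma integrals in the remaining variables.\<close>

definition mellin :: "(nat \<Rightarrow> int) \<Rightarrow> int \<Rightarrow> complex \<Rightarrow> complex" where
  "mellin a b s = Gamma s / Gamma (2 * s) * (\<Prod>i=1..n-2. Gamma (s + of_int (a i)))
     * (Gamma (s + of_int b) * Gamma (s - of_int b))"

lemma mellin_cong: "(\<And>i. i \<in> {1..n-2} \<Longrightarrow> a i = a' i) \<Longrightarrow> mellin a b s = mellin a' b s"
  by (simp add: mellin_def)

lemma mellin_uminus: "mellin a (- b) s = mellin a b s"
  by (simp add: mellin_def mult.commute)

lemma mellin_up:
  assumes "non_half s" "i \<in> {1..n-2}"
  shows "mellin (a(i := a i + 1)) b s = (s + of_int (a i)) * mellin a b s"
proof -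
  have "(\<Prod>k\<in>{1..n-2} - {i}. Gamma (s + of_int ((a(i := a i + 1)) k)))
      = (\<Prod>k\<in>{1..n-2} - {i}. Gamma (s + of_int (a k)))"
    by (rule prod.cong) auto
  moreover have "Gamma (s + of_int (a i + 1)) = (s + of_int (a i)) * Gamma (s + of_int (a i))"
    using Gamma_shift(3) [of "s + of_int (a i)"] assms(1) by (simp add: add.assoc)
  ultimately show ?thesis
    by (simp add: mellin_def prod.remove [OF _ assms(2)])
qed

lemma mellin_down:
  assumes s: "non_half s"
  shows "2 * (mellin (dec a) b (s + 1) + mellin (dec a) (b - 1) (s + 1)) = (s - of_int b) * mellin a b s"
proof -
  let ?P = "\<Prod>i=1..n-2. Gamma (s + of_int (a i))"
  let ?b = "of_int b :: complex"
  have ring_identity: "2 * (c * P * ((s + b) * x * ((s - b) * y)) + c * P * (x * ((s - b + 1) * ((s - b) * y))))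
      = 2 * c * P * ((2 * s + 1) * (s - b) * (x * y))" for c P b x y :: complex
    by (simp add: algebra_simps)
  have "non_half (s + ?b)" "non_half (s - ?b)" "non_half (s - ?b + 1)"
    using s by simp_all
  note g = this [THEN Gamma_shift(3)]
  have "s + 1 + ?b = s + ?b + 1" "s + 1 - ?b = s - ?b + 1"
    "s + 1 + of_int (b - 1) = s + ?b" "s + 1 - of_int (b - 1) = s - ?b + 1 + 1"
    by simp_all
  then have "Gamma (s + 1 + ?b) = (s + ?b) * Gamma (s + ?b)"
    "Gamma (s + 1 - ?b) = (s - ?b) * Gamma (s - ?b)"
    "Gamma (s + 1 - of_int (b - 1)) = (s - ?b + 1) * ((s - ?b) * Gamma (s - ?b))"
    "Gamma (s + 1 + of_int (b - 1)) = Gamma (s + ?b)"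
    by (simp_all only: g)
  moreover have "(\<Prod>i=1..n-2. Gamma (s + 1 + of_int (dec a i))) = ?P"
    by simp
  ultimately have "2 * (mellin (dec a) b (s + 1) + mellin (dec a) (b - 1) (s + 1))
      = 2 * (s * Gamma s / ((2 * s + 1) * (2 * s) * Gamma (2 * s)) * ?P *
          ((s + ?b) * Gamma (s + ?b) * ((s - ?b) * Gamma (s - ?b)))
        + s * Gamma s / ((2 * s + 1) * (2 * s) * Gamma (2 * s)) * ?P *
          (Gamma (s + ?b) * ((s - ?b + 1) * ((s - ?b) * Gamma (s - ?b)))))"
    by (simp only: mellin_def Gamma_shift(3,6) [OF s])
  also have "\<dots> = 2 * (s * Gamma s / ((2 * s + 1) * (2 * s) * Gamma (2 * s))) * ?P *
        ((2 * s + 1) * (s - ?b) * (Gamma (s + ?b) * Gamma (s - ?b)))"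
    by (rule ring_identity)
  also have "\<dots> = (2 * s * (2 * s + 1)) / ((2 * s + 1) * (2 * s)) * ((s - ?b) * mellin a b s)"
    by (simp add: mellin_def)
  also have "\<dots> = (s - ?b) * mellin a b s"
    using Gamma_shift(1,5) [OF s] by simp
  finally show ?thesis .
qed

lemma mellin_down':
  assumes s: "non_half s"
  shows "2 * (mellin (dec a) (b + 1) (s + 1) + mellin (dec a) b (s + 1)) = (s + of_int b) * mellin a b s"
proof -
  have "mellin (dec a) (- b - 1) (s + 1) = mellin (dec a) (b + 1) (s + 1)"
    using mellin_uminus [of "dec a" "b + 1" "s + 1"] by simp
  then show ?thesis
    using mellin_down [OF s, of a "- b"] by (simp add: mellin_uminus add.commute)
qed

text \<open>The integral is taken at \<open>\<theta> = 1\<close>.  Restricting to one degree \<open>d\<close> of the grading for which \<open>f\<close> has degree one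
  loses no information, since there the power of \<open>\<theta>\<close> is determined by the other exponents.\<close>

definition wdeg :: "(var \<Rightarrow>\<^sub>0 int) \<Rightarrow> int" where
  "wdeg e = Poly_Mapping.lookup e Theta + (\<Sum>i=1..n-2. Poly_Mapping.lookup e (U i))
     + int (n - 1) * (Poly_Mapping.lookup e Q + Poly_Mapping.lookup e (U (n-1)))"

definition mweight :: "complex \<Rightarrow> (var \<Rightarrow>\<^sub>0 int) \<Rightarrow> complex" where
  "mweight s e = mellin (\<lambda>i. Poly_Mapping.lookup e (U i)) (Poly_Mapping.lookup e (U (n-1)))
     (s + of_int (Poly_Mapping.lookup e Q + Poly_Mapping.lookup e (U (n-1))))"

definition pairing :: "int \<Rightarrow> complex \<Rightarrow> laurent \<Rightarrow> complex" where
  "pairing d s p = (\<Sum>e\<in>Poly_Mapping.keys p. Poly_Mapping.lookup p e * (if wdeg e = d then mweight s e else 0))"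

lemma pairing_add: "pairing d s (p + p') = pairing d s p + pairing d s p'"
  unfolding pairing_def
  by (rule setsum_keys_plus_distrib [where f = "\<lambda>e c. c * (if wdeg e = d then mweight s e else 0)"])
    (simp_all add: distrib_right)

lemma pairing_single: "pairing d s (Poly_Mapping.single e c) = (if wdeg e = d then c * mweight s e else 0)"
  by (simp add: pairing_def)

lemma lam_0 [simp]: "pairing d s 0 = 0"
  by (simp add: pairing_def)

lemma pairing_uminus: "pairing d s (- p) = - pairing d s p"
  using pairing_add [of d s p "- p"] by (simp add: eq_neg_iff_add_eq_0 add.commute)

lemma pairing_diff: "pairing d s (p - p') = pairing d s p - pairing d s p'"
  using pairing_add [of d s p "- p'"] by (simp add: pairing_uminus)

lemma pairing_sum: "pairing d s (\<Sum>i\<in>I. p i) = (\<Sum>i\<in>I. pairing d s (p i))"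
  by (induction I rule: infinite_finite_induct) (simp_all add: pairing_add)

lemma wdeg_add: "wdeg (e + e') = wdeg e + wdeg e'"
  by (simp add: wdeg_def lookup_add sum.distrib algebra_simps)

lemma wdeg_single: "wdeg (Poly_Mapping.single Theta j) = j" "wdeg (Poly_Mapping.single Q j) = int (n - 1) * j"
    "wdeg (Poly_Mapping.single (U (n-1)) j) = int (n - 1) * j"
    "i \<in> {1..n-2} \<Longrightarrow> wdeg (Poly_Mapping.single (U i) j) = j"
proof -
  have "(\<Sum>i=1..n-2. Poly_Mapping.lookup (Poly_Mapping.single (U (n-1)) j) (U i)) = 0"
    by (rule sum.neutral) (use n_ge_3 in \<open>auto simp: lookup_single\<close>)
  then show "wdeg (Poly_Mapping.single (U (n-1)) j) = int (n - 1) * j"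
    by (simp add: wdeg_def lookup_single)
  assume i: "i \<in> {1..n-2}"
  have "(\<Sum>k=1..n-2. Poly_Mapping.lookup (Poly_Mapping.single (U i) j) (U k)) = (\<Sum>k=1..n-2. if k = i then j else 0)"
    by (rule sum.cong) (auto simp: lookup_single when_def)
  moreover have "i \<noteq> n - 1"
    using i n_ge_3 by auto
  ultimately show "wdeg (Poly_Mapping.single (U i) j) = j"
    using i by (simp add: wdeg_def lookup_single)
qed (simp_all add: wdeg_def lookup_single)

lemma wdeg_tvol: "wdeg (uexp {1..n-1} (\<lambda>_. -1)) = 3 - 2 * int n"
proof -
  have "(\<Sum>i=1..n-2. Poly_Mapping.lookup (uexp {1..n-1} (\<lambda>_. -1)) (U i)) = (\<Sum>i=1..n-2. - 1)"
    by (rule sum.cong) (auto simp: lookup_uexp)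
  also have "\<dots> = 2 - int n"
    using n_ge_3 by simp
  finally show ?thesis
    using n_ge_3 by (simp add: wdeg_def lookup_uexp)
qed

abbreviation expU :: "(var \<Rightarrow>\<^sub>0 int) \<Rightarrow> nat \<Rightarrow> int" where
  "expU e \<equiv> \<lambda>i. Poly_Mapping.lookup e (U i)"

definition q_shift :: "(var \<Rightarrow>\<^sub>0 int) \<Rightarrow> int" where
  "q_shift e = Poly_Mapping.lookup e Q + Poly_Mapping.lookup e (U (n-1))"

lemma pairing_theta_mult: "pairing d s (\<theta> * Poly_Mapping.single e c) = pairing (d - 1) s (Poly_Mapping.single e c)"
  by (simp add: xpow_def mult_single pairing_single wdeg_add wdeg_single mweight_def lookup_add lookup_single
      algebra_simps)

lemma pairing_U_mult:
  assumes "i \<in> {1..n-2}"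
  shows "pairing d s (xpow (U i) 1 * Poly_Mapping.single e c) = (if wdeg e = d - 1
    then c * mellin ((expU e)(i := expU e i + 1)) (expU e (n-1)) (s + of_int (q_shift e)) else 0)"
proof -
  have "i \<noteq> n - 1"
    using assms n_ge_3 by auto
  moreover have "mellin (expU (Poly_Mapping.single (U i) 1 + e)) b t = mellin ((expU e)(i := expU e i + 1)) b t" for b t
    by (rule mellin_cong) (auto simp: lookup_add lookup_single)
  ultimately show ?thesis
    using assms
    by (auto simp: xpow_def mult_single pairing_single wdeg_add wdeg_single mweight_def lookup_add lookup_single
        q_shift_def)
qed

lemma mweight_eq: "mweight s e = mellin (expU e) (expU e (n-1)) (s + of_int (q_shift e))"
  by (simp add: mweight_def q_shift_def)

text \<open>The three monomials of \<open>F\<close> raise the Mellin variable by one, lower all exponents \<open>a\<^sub>i\<close> and change the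
  exponent \<open>b\<close> of \<open>u\<^sub>n\<^sub>-\<^sub>1\<close> by \<open>1\<close>, \<open>0\<close> or \<open>-1\<close>.\<close>

lemma pairing_tvol_mult:
  fixes e c
  defines "m \<equiv> Poly_Mapping.single e c" and "b \<equiv> expU e (n-1)" and "t \<equiv> \<lambda>s. s + of_int (q_shift e)"
  shows "pairing d s (u * (u * (tvol * m)))
      = (if wdeg e = d - 1 then c * mellin (dec (expU e)) (b + 1) (t s + 1) else 0)"
    and "pairing d s (u * (q * (tvol * m)))
      = (if wdeg e = d - 1 then c * mellin (dec (expU e)) b (t s + 1) else 0)"
    and "pairing d s (q * (q * (tvol * m)))
      = (if wdeg e = d - 1 then c * mellin (dec (expU e)) (b - 1) (t s + 1) else 0)"
proof -
  let ?T = "uexp {1..n-1} (\<lambda>_. -1)" and ?u = "Poly_Mapping.single (U (n-1)) (1 :: int)"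
    and ?q = "Poly_Mapping.single Q (1 :: int)"
  have lookups: "Poly_Mapping.lookup ?T (U (n-1)) = -1" "Poly_Mapping.lookup ?T Q = 0"
    "Poly_Mapping.lookup ?u (U (n-1)) = 1" "Poly_Mapping.lookup ?u Q = 0"
    "Poly_Mapping.lookup ?q (U (n-1)) = 0" "Poly_Mapping.lookup ?q Q = 1"
    using n_ge_3 by (auto simp: lookup_uexp lookup_single)
  have n: "int (n - 1) = int n - 1"
    using n_ge_3 by simp
  have *: "pairing d s (Poly_Mapping.single v 1 * (Poly_Mapping.single w 1 * (tvol * m)))
      = (if wdeg e = d - 1 then c * mellin (dec (expU e))
          (expU v (n-1) + expU w (n-1) - 1 + b) (t s + 1) else 0)"
    if vw: "v \<in> {?u, ?q}" "w \<in> {?u, ?q}" for v w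
  proof -
    have "mellin (expU (v + (w + (?T + e)))) x y = mellin (dec (expU e)) x y" for x y
    proof (rule mellin_cong)
      fix i assume "i \<in> {1..n-2}"
      then have "i \<in> {1..n-1}" "i \<noteq> n - 1"
        using n_ge_3 by auto
      with vw show "expU (v + (w + (?T + e))) i = dec (expU e) i"
        by (auto simp: lookup_add lookup_uexp lookup_single)
    qed
    moreover have "wdeg (v + (w + (?T + e))) = wdeg e + 1"
      using vw by (auto simp: wdeg_add wdeg_single wdeg_tvol n)
    moreover have "q_shift (v + (w + (?T + e))) = q_shift e + 1"
      using vw by (auto simp: q_shift_def lookup_add lookups)
    moreover have "expU (v + (w + (?T + e))) (n-1) = expU v (n-1) + expU w (n-1) - 1 + b"
      by (simp add: lookup_add lookups b_def)
    moreover have "Poly_Mapping.single v 1 * (Poly_Mapping.single w 1 * (tvol * m))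
        = Poly_Mapping.single (v + (w + (?T + e))) c"
      by (simp add: tvol_single m_def mult_single)
    moreover have "wdeg e + 1 = d \<longleftrightarrow> wdeg e = d - 1"
      by auto
    moreover have "s + of_int (q_shift e + 1) = t s + 1"
      by (simp add: t_def)
    ultimately show ?thesis
      by (simp only: pairing_single mweight_eq)
  qed
  show "pairing d s (u * (u * (tvol * m)))
      = (if wdeg e = d - 1 then c * mellin (dec (expU e)) (b + 1) (t s + 1) else 0)"
    "pairing d s (u * (q * (tvol * m)))
      = (if wdeg e = d - 1 then c * mellin (dec (expU e)) b (t s + 1) else 0)"
    "pairing d s (q * (q * (tvol * m)))
      = (if wdeg e = d - 1 then c * mellin (dec (expU e)) (b - 1) (t s + 1) else 0)"
    using * [of ?u ?u] * [of ?u ?q] * [of ?q ?q] by (simp_all add: xpow_def lookups add.commute)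
qed

lemma mellin_combinations:
  assumes "non_half s"
  shows "t * mellin a b s - (s + t) * mellin a b s
      + (mellin (dec a) (b + 1) (s + 1) + mellin (dec a) b (s + 1)
        + (mellin (dec a) b (s + 1) + mellin (dec a) (b - 1) (s + 1))) = 0"
    and "of_int b * mellin a b s - mellin (dec a) (b + 1) (s + 1) + mellin (dec a) (b - 1) (s + 1) = 0"
proof -
  have "t * w - (s + t) * w + (z + x + (x + y)) = 0" "c * w - z + y = 0"
    if "2 * (x + y) = (s - c) * w" "2 * (z + x) = (s + c) * w" for c w x y z :: complex
  proof -
    have "2 * (t * w - (s + t) * w + (z + x + (x + y))) = 2 * (z + x) + 2 * (x + y) - 2 * s * w"
      "2 * (c * w - z + y) = 2 * (x + y) - 2 * (z + x) + 2 * c * w"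
      by (simp_all add: algebra_simps)
    then have "2 * (t * w - (s + t) * w + (z + x + (x + y))) = 2 * 0" "2 * (c * w - z + y) = 2 * 0"
      unfolding that by (simp_all add: algebra_simps)
    then show "t * w - (s + t) * w + (z + x + (x + y)) = 0" "c * w - z + y = 0"
      by (simp_all only: mult_cancel_left) simp_all
  qed
  note * = this [OF mellin_down [OF assms, of a b] mellin_down' [OF assms, of a b]]
  show "t * mellin a b s - (s + t) * mellin a b s
      + (mellin (dec a) (b + 1) (s + 1) + mellin (dec a) b (s + 1)
        + (mellin (dec a) b (s + 1) + mellin (dec a) (b - 1) (s + 1))) = 0"
    "of_int b * mellin a b s - mellin (dec a) (b + 1) (s + 1) + mellin (dec a) (b - 1) (s + 1) = 0"
    by (fact *)+
qed

lemma pairing_twisted_U_single: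
  assumes s: "non_half s" and i: "i \<in> {1..n-2}"
  shows "pairing d s (twisted (U i) (Poly_Mapping.single e c)) = 0"
proof -
  let ?m = "Poly_Mapping.single e c"
  let ?b = "expU e (n-1)" and ?S = "s + of_int (q_shift e)" and ?a = "expU e"
  have S: "non_half ?S"
    using s by simp
  have eq: "twisted (U i) ?m = \<theta> * Poly_Mapping.single e (of_int (?a i) * c) - xpow (U i) 1 * ?m
      + (u * (u * (tvol * ?m)) + u * (q * (tvol * ?m)) + u * (q * (tvol * ?m)) + q * (q * (tvol * ?m)))"
    by (simp add: twisted_def ldiff_single ldiff_potential_U [OF i] F_def power2_eq_square algebra_simps)
  have "pairing d s (twisted (U i) ?m) = (if wdeg e = d - 1 then c * (of_int (?a i) * mellin ?a ?b ?S
      - mellin (?a(i := ?a i + 1)) ?b ?S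
      + (mellin (dec ?a) (?b + 1) (?S + 1) + mellin (dec ?a) ?b (?S + 1)
        + (mellin (dec ?a) ?b (?S + 1) + mellin (dec ?a) (?b - 1) (?S + 1)))) else 0)"
    unfolding eq pairing_add pairing_diff pairing_theta_mult pairing_U_mult [OF i] pairing_tvol_mult pairing_single mweight_eq
    by (simp add: algebra_simps)
  also have "\<dots> = 0"
    unfolding mellin_up [OF S i, of ?a ?b] using mellin_combinations(1) [OF S, of "of_int (?a i)" ?a ?b]
    by simp
  finally show ?thesis .
qed

lemma pairing_twisted_u_single:
  assumes s: "non_half s"
  shows "pairing d s (twisted (U (n-1)) (Poly_Mapping.single e c)) = 0"
proof -
  let ?m = "Poly_Mapping.single e c"
  let ?b = "expU e (n-1)" and ?S = "s + of_int (q_shift e)" and ?a = "expU e"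
  have S: "non_half ?S"
    using s by simp
  have eq: "twisted (U (n-1)) ?m = \<theta> * Poly_Mapping.single e (of_int ?b * c)
      - u * (u * (tvol * ?m)) + q * (q * (tvol * ?m))"
    by (simp add: twisted_def ldiff_single ldiff_potential_u power2_eq_square algebra_simps)
  have "pairing d s (twisted (U (n-1)) ?m) = (if wdeg e = d - 1 then c * (of_int ?b * mellin ?a ?b ?S
      - mellin (dec ?a) (?b + 1) (?S + 1) + mellin (dec ?a) (?b - 1) (?S + 1)) else 0)"
    unfolding eq pairing_add pairing_diff pairing_theta_mult pairing_tvol_mult pairing_single mweight_eq
    by (simp add: algebra_simps)
  then show ?thesis
    unfolding mellin_combinations(2) [OF S] by simp
qed

text \<open>Integrals of total derivatives vanish; on monomials this is the contiguity of \<open>mellin\<close>.\<close>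

lemma pairing_Rel:
  assumes "non_half s" "r \<in> Rel" shows "pairing d s r = 0"
proof -
  obtain h where h: "r = (\<Sum>i=1..n-1. twisted (U i) (h i))"
    using assms(2) by (rule RelE) blast
  have "pairing d s (twisted (U i) p) = 0" if i: "i \<in> {1..n-1}" for i p
  proof (induction p rule: laurent_induct)
    case (single e c)
    have "i \<in> {1..n-2} \<or> i = n - 1"
      using i n_ge_3 by auto
    then show ?case
      using pairing_twisted_U_single [OF assms(1)] pairing_twisted_u_single [OF assms(1)] by blast
  qed (simp_all add: twisted_add pairing_add)
  then show ?thesis
    by (simp add: h pairing_sum)
qed

text \<open>Integration by parts in \<open>q\<close>.\<close>

lemma pairing_B:
  assumes s: "non_half s"
  shows "pairing d s (B h) = s * pairing (d - 1) s h"
proof (induction h rule: laurent_induct)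
  case (single e c)
  let ?m = "Poly_Mapping.single e c"
  let ?b = "expU e (n-1)" and ?S = "s + of_int (q_shift e)" and ?a = "expU e"
  have S: "non_half ?S"
    using s by simp
  have eq: "B ?m = u * (q * (tvol * ?m)) + u * (q * (tvol * ?m)) + (q * (q * (tvol * ?m)) + q * (q * (tvol * ?m)))
      - \<theta> * Poly_Mapping.single e (of_int (Poly_Mapping.lookup e Q) * c)"
    by (simp add: B_def twisted_def ldiff_single ldiff_potential_Q algebra_simps)
  have "pairing d s (B ?m) = (if wdeg e = d - 1 then c * (2 * (mellin (dec ?a) ?b (?S + 1)
      + mellin (dec ?a) (?b - 1) (?S + 1)) - of_int (Poly_Mapping.lookup e Q) * mellin ?a ?b ?S) else 0)"
    unfolding eq pairing_add pairing_diff pairing_theta_mult pairing_tvol_mult pairing_single mweight_eq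
    by (simp add: algebra_simps)
  then show ?case
    unfolding mellin_down [OF S]
    by (simp add: pairing_single mweight_def q_shift_def algebra_simps)
qed (simp_all add: B_add pairing_add algebra_simps)

lemma pairing_base:
  assumes "c \<in> base"
  shows "pairing d s (c * h) = (\<Sum>e\<in>Poly_Mapping.keys c. Poly_Mapping.lookup c e *
    pairing (d - wdeg e) (s + of_int (Poly_Mapping.lookup e Q)) h)"
proof -
  have single: "pairing d s (Poly_Mapping.single e z * p) = z * pairing (d - wdeg e) (s + of_int (Poly_Mapping.lookup e Q)) p"
    if "e \<in> Poly_Mapping.keys c" for e z p
  proof (induction p rule: laurent_induct)
    case (single e' z')
    have "Poly_Mapping.keys e \<subseteq> {Q, Theta}"
      using that assms by (simp add: base_iff laurent_in_iff)
    then have "U i \<notin> Poly_Mapping.keys e" for i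
      by blast
    then have "Poly_Mapping.lookup e (U i) = 0" for i
      by (simp add: in_keys_iff)
    then show ?case
      by (auto simp: mult_single pairing_single wdeg_add mweight_def lookup_add algebra_simps)
  qed (simp_all add: pairing_add algebra_simps)
  have "c * h = (\<Sum>e\<in>Poly_Mapping.keys c. Poly_Mapping.single e (Poly_Mapping.lookup c e) * h)"
    by (subst (1) laurent_eq_sum [of c, symmetric]) (rule sum_distrib_right)
  then show ?thesis
    by (simp add: pairing_sum single)
qed

section \<open>Independence of the powers of \<open>B\<close>\<close>

definition period :: "complex \<Rightarrow> complex" where
  "period s = mellin (\<lambda>_. 0) 0 s"

lemma period_nonzero: "non_half s \<Longrightarrow> period s \<noteq> 0"
  by (simp add: period_def mellin_def Gamma_shift)

lemma period_recurrence:
  assumes s: "non_half s"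
  shows "2 * (2 * s + 1) * period (s + 1) = s ^ n * period s"
proof -
  let ?g = "Gamma s" and ?h = "Gamma (2 * s)"
  have "s ^ n = s ^ (n - 2) * (s * s)"
  proof -
    have "n - 2 + 2 = n"
      using n_ge_3 by simp
    moreover have "s ^ (n - 2 + 2) = s ^ (n - 2) * (s * s)"
      by (simp only: power_add power2_eq_square)
    ultimately show ?thesis by (simp only:)
  qed
  moreover have "period (s + 1) = s * ?g / ((2 * s + 1) * (2 * s) * ?h) * (s * ?g) ^ (n - 2) * ((s * ?g) * (s * ?g))"
    unfolding period_def mellin_def Gamma_shift(6) [OF s] by (simp add: Gamma_shift(3) [OF s])
  moreover have "period s = ?g / ?h * ?g ^ (n - 2) * (?g * ?g)"
    by (simp add: period_def mellin_def)
  moreover have "2 * D * (s * g / (D * (2 * s) * h) * (c * G) * ((s * g) * (s * g))) = c * (s * s) * (g / h * G * (g * g))"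
    if "D \<noteq> 0" "h \<noteq> 0" for D g h c G
    using that Gamma_shift(1) [OF s] by (simp add: divide_simps)
  ultimately show ?thesis
    using Gamma_shift(4,5) [OF s] by (simp only: power_mult_distrib)
qed

lemma pairing_B_pow:
  assumes "non_half s"
  shows "pairing d s ((B ^^ i) 1) = (if d = int i then s ^ i * period s else 0)"
proof (induction i arbitrary: d)
  case 0
  have "pairing d s (Poly_Mapping.single 0 1) = (if d = 0 then period s else 0)"
    by (simp add: pairing_single wdeg_def mweight_def period_def del: single_one)
  then show ?case by simp
next
  case (Suc i)
  then show ?case
    by (auto simp: pairing_B [OF assms])
qed

text \<open>In a fixed degree \<open>d\<close>, the part of \<open>c\<^sub>i\<close> with a given power \<open>q\<^sup>k\<close> is a single monomial.  Applying
  \<open>pairing d s\<close> therefore gives a relation between the numbers \<open>period (s + k)\<close> whose coefficient at \<open>k\<close> is a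
  polynomial in \<open>s + k\<close> of degree less than \<open>n\<close>.\<close>

lemma B_pow_independent:
  assumes c: "\<And>i. i < n \<Longrightarrow> c i \<in> base" and rel: "(\<Sum>i<n. c i * (B ^^ i) 1) \<in> Rel"
  shows "\<forall>i<n. c i = 0"
proof -
  define K where "K = (\<Union>i<n. (\<lambda>e. Poly_Mapping.lookup e Q) ` Poly_Mapping.keys (c i))"
  have fin: "finite K"
    by (simp add: K_def)
  define bexp where "bexp k j = Poly_Mapping.single Q k + Poly_Mapping.single Theta j" for k j :: int
  have bexp_Q: "Poly_Mapping.lookup (bexp k j) Q = k" and wdeg_bexp: "wdeg (bexp k j) = j + int (n - 1) * k" for k j
    by (simp_all add: bexp_def lookup_add lookup_single wdeg_add wdeg_single)
  have bexp_eq: "bexp (Poly_Mapping.lookup e Q) (wdeg e - int (n - 1) * Poly_Mapping.lookup e Q) = e"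
    if "i < n" "e \<in> Poly_Mapping.keys (c i)" for i e
  proof -
    have "Poly_Mapping.keys e \<subseteq> {Q, Theta}"
      using that c by (simp add: base_iff laurent_in_iff)
    then have "U k \<notin> Poly_Mapping.keys e" for k
      by blast
    then have U: "Poly_Mapping.lookup e (U k) = 0" for k
      by (simp add: in_keys_iff)
    then have "wdeg e - int (n - 1) * Poly_Mapping.lookup e Q = Poly_Mapping.lookup e Theta"
      by (simp add: wdeg_def)
    moreover have "bexp (Poly_Mapping.lookup e Q) (Poly_Mapping.lookup e Theta) = e"
    proof (rule poly_mapping_eqI)
      fix v show "Poly_Mapping.lookup (bexp (Poly_Mapping.lookup e Q) (Poly_Mapping.lookup e Theta)) v
          = Poly_Mapping.lookup e v"
        using U by (cases v) (auto simp: bexp_def lookup_add lookup_single)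
    qed
    ultimately show ?thesis by simp
  qed
  define p where "p d i k = Poly_Mapping.lookup (c i) (bexp k (d - int i - int (n - 1) * k))" for d i k
  have p_0: "p d i k = 0" if "i < n" "k \<in> K" for d i k
  proof -
    define R where "R k = (\<Sum>i<n. monom (p d i k) i)" for k
    have "\<forall>k\<in>K. R k = 0"
    proof (rule shift_recurrence_independent [OF period_nonzero period_recurrence fin])
      show "degree (R k) < n" for k
        unfolding R_def
        by (rule degree_sum_less) (use n_ge_3 in \<open>auto intro: le_less_trans [OF degree_monom_le]\<close>)
      fix s assume s: "non_half s"
      have inner: "pairing d s (c i * (B ^^ i) 1)
          = (\<Sum>k\<in>K. p d i k * ((s + of_int k) ^ i * period (s + of_int k)))" if i: "i < n" for i
      proof -
        let ?S = "{e \<in> Poly_Mapping.keys (c i). d - wdeg e = int i}"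
        have S_facts: "bexp (Poly_Mapping.lookup e Q) (d - int i - int (n - 1) * Poly_Mapping.lookup e Q) = e"
          "p d i (Poly_Mapping.lookup e Q) = Poly_Mapping.lookup (c i) e" "Poly_Mapping.lookup e Q \<in> K"
          if "e \<in> ?S" for e
        proof -
          from that have "d - int i = wdeg e" by auto
          then show "bexp (Poly_Mapping.lookup e Q) (d - int i - int (n - 1) * Poly_Mapping.lookup e Q) = e"
            using bexp_eq [OF i] that by simp
          then show "p d i (Poly_Mapping.lookup e Q) = Poly_Mapping.lookup (c i) e"
            by (simp only: p_def)
          show "Poly_Mapping.lookup e Q \<in> K"
            using that i unfolding K_def by blast
        qed
        have "pairing d s (c i * (B ^^ i) 1) = (\<Sum>e\<in>Poly_Mapping.keys (c i). if d - wdeg e = int i then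
            Poly_Mapping.lookup (c i) e * ((s + of_int (Poly_Mapping.lookup e Q)) ^ i
              * period (s + of_int (Poly_Mapping.lookup e Q))) else 0)"
          using s by (auto simp: pairing_base [OF c [OF i]] pairing_B_pow intro!: sum.cong)
        also have "\<dots> = (\<Sum>e\<in>?S. Poly_Mapping.lookup (c i) e * ((s + of_int (Poly_Mapping.lookup e Q)) ^ i
              * period (s + of_int (Poly_Mapping.lookup e Q))))"
          by (rule sum.inter_filter [symmetric]) simp
        also have "\<dots> = (\<Sum>k\<in>K. p d i k * ((s + of_int k) ^ i * period (s + of_int k)))"
        proof (rule sum.reindex_bij_witness_not_neutral
            [where S' = "{}" and T' = "{k \<in> K. p d i k = 0}"
              and i = "\<lambda>k. bexp k (d - int i - int (n - 1) * k)" and j = "\<lambda>e. Poly_Mapping.lookup e Q"])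
          fix e assume "e \<in> ?S - {}"
          then show "bexp (Poly_Mapping.lookup e Q) (d - int i - int (n - 1) * Poly_Mapping.lookup e Q) = e"
            "Poly_Mapping.lookup e Q \<in> K - {k \<in> K. p d i k = 0}"
            using S_facts [of e] by (auto simp: in_keys_iff)
        next
          fix e assume "e \<in> ?S"
          then show "p d i (Poly_Mapping.lookup e Q) * ((s + of_int (Poly_Mapping.lookup e Q)) ^ i
              * period (s + of_int (Poly_Mapping.lookup e Q)))
            = Poly_Mapping.lookup (c i) e * ((s + of_int (Poly_Mapping.lookup e Q)) ^ i
              * period (s + of_int (Poly_Mapping.lookup e Q)))"
            by (simp only: S_facts(2))
        qed (use fin in \<open>auto simp: p_def in_keys_iff bexp_Q wdeg_bexp\<close>)
        finally show ?thesis .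
      qed
      have "0 = pairing d s (\<Sum>i<n. c i * (B ^^ i) 1)"
        using pairing_Rel [OF s rel] by simp
      also have "\<dots> = (\<Sum>i<n. \<Sum>k\<in>K. p d i k * ((s + of_int k) ^ i * period (s + of_int k)))"
        by (simp add: pairing_sum inner)
      also have "\<dots> = (\<Sum>k\<in>K. \<Sum>i<n. p d i k * ((s + of_int k) ^ i * period (s + of_int k)))"
        by (rule sum.swap)
      also have "\<dots> = (\<Sum>k\<in>K. poly (R k) (s + of_int k) * period (s + of_int k))"
        by (simp add: R_def poly_sum poly_monom sum_distrib_right mult.assoc)
      finally show "(\<Sum>k\<in>K. poly (R k) (s + of_int k) * period (s + of_int k)) = 0"
        by simp
    qed
    then have "coeff (R k) i = 0"
      using that by simp
    then show ?thesis
      using that(1) by (simp add: R_def coeff_sum)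
  qed
  show ?thesis
  proof (intro allI impI)
    fix i assume i: "i < n"
    have "Poly_Mapping.keys (c i) = {}"
    proof (rule ccontr)
      assume "Poly_Mapping.keys (c i) \<noteq> {}"
      then obtain e where e: "e \<in> Poly_Mapping.keys (c i)" by blast
      then have "Poly_Mapping.lookup e Q \<in> K"
        using i by (auto simp: K_def)
      then have "p (wdeg e + int i) i (Poly_Mapping.lookup e Q) = 0"
        using p_0 i by simp
      then have "Poly_Mapping.lookup (c i) e = 0"
        using bexp_eq [OF i e] by (simp add: p_def)
      with e show False by (simp add: in_keys_iff)
    qed
    then show "c i = 0" by simp
  qed
qed

section \<open>The quantum differential system inside the Gauss-Manin system\<close>

definition comb :: "(nat \<Rightarrow> laurent) \<Rightarrow> laurent" where
  "comb v = (\<Sum>i<n. v i * beta i)"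

lemma comb_in_L [simp]: "(\<And>i. i < n \<Longrightarrow> v i \<in> base) \<Longrightarrow> comb v \<in> L"
  by (auto simp: comb_def intro!: L_sum L_closed)

text \<open>The \<open>beta i\<close> and the \<open>B\<^sup>i 1\<close> differ by a unitriangular change of basis.\<close>

lemma comb_independent:
  assumes v: "\<And>i. i < n \<Longrightarrow> v i \<in> base" and "comb v \<in> Rel" and "i < n"
  shows "v i = 0"
proof -
  \<comment> \<open>coordinates with respect to the powers of \<open>B\<close>\<close>
  define w where "w = v(0 := v 0 - 2 * q * v (n - 1))"
  have n: "n - 1 < n" "0 < n" "n - 1 \<noteq> 0"
    using n_ge_3 by auto
  have "v i * beta i = v i * (B ^^ i) 1 - (if i = n - 1 then 2 * q * v (n - 1) else 0)" for i
    by (simp add: beta_def algebra_simps)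
  then have "comb v = (\<Sum>i<n. v i * (B ^^ i) 1) - (\<Sum>i<n. if i = n - 1 then 2 * q * v (n - 1) else 0)"
    unfolding comb_def by (simp add: sum_subtractf)
  also have "\<dots> = (\<Sum>i<n. v i * (B ^^ i) 1) - (\<Sum>i<n. if i = 0 then 2 * q * v (n - 1) else 0)"
    using n by simp
  also have "\<dots> = (\<Sum>i<n. v i * (B ^^ i) 1 - (if i = 0 then 2 * q * v (n - 1) else 0))"
    by (simp only: sum_subtractf)
  also have "\<dots> = (\<Sum>i<n. w i * (B ^^ i) 1)"
    by (rule sum.cong) (auto simp: w_def algebra_simps)
  finally have "(\<Sum>i<n. w i * (B ^^ i) 1) \<in> Rel"
    using assms(2) by simp
  moreover have "w i \<in> base" if "i < n" for i
    using v that n by (simp add: w_def)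
  ultimately have w: "w i = 0" if "i < n" for i
    using B_pow_independent that by blast
  then have "v (n - 1) = 0"
    using w [of "n - 1"] n by (simp add: w_def)
  then show ?thesis
    using w [OF \<open>i < n\<close>] by (simp add: w_def split: if_splits)
qed

lemma comb_diff: "comb v - comb w = comb (\<lambda>i. v i - w i)"
  by (simp add: comb_def sum_subtractf algebra_simps)

lemma comb_eq_cls:
  assumes "\<And>i. i < n \<Longrightarrow> v i \<in> base" "\<And>i. i < n \<Longrightarrow> w i \<in> base" "cls (comb v) = cls (comb w)" "i < n"
  shows "v i = w i"
  using comb_independent [of "\<lambda>i. v i - w i" i] assms by (simp add: cls_cong comb_diff)

lemma cls_surj:
  assumes "h \<in> L" obtains v where "\<And>i. i < n \<Longrightarrow> v i \<in> base" "cls h = cls (comb v)"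
proof -
  obtain v r where "\<forall>i<n. v i \<in> base" "r \<in> Rel" "h = comb v + r"
    using L_subset_beta_span [OF assms] unfolding beta_span_def comb_def by blast
  then show thesis
    using that [of v] by (simp add: cls_cong)
qed

lemma GM_surj:
  assumes "x \<in> carrier (GM n)" obtains v where "\<And>i. i < n \<Longrightarrow> v i \<in> base" "x = cls (comb v)"
proof -
  obtain h where h: "h \<in> L" "x = cls h"
    using assms by (auto simp: GM_carrier)
  obtain v where "\<And>i. i < n \<Longrightarrow> v i \<in> base" "cls h = cls (comb v)"
    using cls_surj [OF \<open>h \<in> L\<close>] by blast
  with h(2) show thesis
    by (intro that) auto
qed

lemma cring_base_ring: "cring base_ring"
  unfolding base_ring_def by (rule cring_laurent_ring)

lemma base_ring_simps [simp]: "x \<otimes>\<^bsub>base_ring\<^esub> y = x * y" "x \<oplus>\<^bsub>base_ring\<^esub> y = x + y"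
    "\<one>\<^bsub>base_ring\<^esub> = 1" "\<zero>\<^bsub>base_ring\<^esub> = 0"
  by (simp_all add: base_ring_def)

lemma module_GM: "module base_ring (GM n)"
proof (rule moduleI [OF cring_base_ring])
  show "abelian_group (GM n)"
  proof (rule abelian_groupI)
    fix x assume "x \<in> carrier (GM n)"
    then obtain h where h: "h \<in> L" "x = cls h"
      by (auto simp: GM_carrier)
    show "\<exists>y\<in>carrier (GM n). y \<oplus>\<^bsub>GM n\<^esub> x = \<zero>\<^bsub>GM n\<^esub>"
      using h by (intro bexI [of _ "cls (- h)"]) (auto simp: GM_carrier GM_add GM_zero)
  qed (auto simp: GM_carrier GM_add GM_zero add_ac)
qed (auto simp: GM_carrier GM_add GM_smult algebra_simps)

lemma GM_finsum:
  assumes "finite I" "\<And>i. i \<in> I \<Longrightarrow> h i \<in> L"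
  shows "(\<Oplus>\<^bsub>GM n\<^esub>i\<in>I. cls (h i)) = cls (\<Sum>i\<in>I. h i)"
proof -
  interpret module base_ring "GM n"
    by (rule module_GM)
  show ?thesis
    using assms
  proof (induction I)
    case empty
    show ?case by (simp add: GM_zero)
  next
    case (insert i I)
    then have "(\<Oplus>\<^bsub>GM n\<^esub>i\<in>insert i I. cls (h i)) = cls (h i) \<oplus>\<^bsub>GM n\<^esub> (\<Oplus>\<^bsub>GM n\<^esub>i\<in>I. cls (h i))"
      by (intro finsum_insert) (auto simp: GM_carrier)
    with insert show ?case
      by (simp add: GM_add)
  qed
qed

lemma module_basis_GM:
  "module_basis base_ring (GM n) ((\<lambda>i. cls (beta i)) ` {..<n})"
  and card_basis: "card ((\<lambda>i. cls (beta i)) ` {..<n}) = n"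
proof -
  let ?b = "\<lambda>i. cls (beta i)" and ?B = "(\<lambda>i. cls (beta i)) ` {..<n}"
  interpret module base_ring "GM n"
    by (rule module_GM)
  have beta: "beta i = comb (bvec i)" if "i < n" for i
    using that by (simp add: comb_def bvec_sum)
  have inj: "inj_on ?b {..<n}"
  proof (rule inj_onI)
    fix i j assume "i \<in> {..<n}" "j \<in> {..<n}" "?b i = ?b j"
    then have "bvec i i = bvec j i"
      using beta by (intro comb_eq_cls [of "bvec i" "bvec j" i]) simp_all
    then show "i = j"
      by (auto simp: bvec_def split: if_splits)
  qed
  then show "card ?B = n"
    by (simp add: card_image)
  have expand: "(\<Oplus>\<^bsub>GM n\<^esub>y\<in>{y \<in> ?B. a y \<noteq> \<zero>\<^bsub>base_ring\<^esub>}. a y \<odot>\<^bsub>GM n\<^esub> y) = cls (comb (\<lambda>i. a (?b i)))"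
    if a: "a \<in> ?B \<rightarrow>\<^sub>E base" for a
  proof -
    let ?I = "{i \<in> {..<n}. a (?b i) \<noteq> 0}"
    have base: "a (?b i) \<in> base" if "i < n" for i
      using a that by auto
    have "{y \<in> ?B. a y \<noteq> \<zero>\<^bsub>base_ring\<^esub>} = ?b ` ?I"
      by auto
    moreover have "inj_on ?b ?I"
      using inj by (rule inj_on_subset) auto
    ultimately have "(\<Oplus>\<^bsub>GM n\<^esub>y\<in>{y \<in> ?B. a y \<noteq> \<zero>\<^bsub>base_ring\<^esub>}. a y \<odot>\<^bsub>GM n\<^esub> y)
        = (\<Oplus>\<^bsub>GM n\<^esub>i\<in>?I. a (?b i) \<odot>\<^bsub>GM n\<^esub> ?b i)"
      using base by (simp only:) (rule finsum_reindex, auto simp: GM_smult GM_carrier)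
    also have "\<dots> = (\<Oplus>\<^bsub>GM n\<^esub>i\<in>?I. cls (a (?b i) * beta i))"
      using base by (intro finsum_cong') (auto simp: GM_smult GM_carrier)
    also have "\<dots> = cls (\<Sum>i\<in>?I. a (?b i) * beta i)"
      using base by (intro GM_finsum) auto
    also have "(\<Sum>i\<in>?I. a (?b i) * beta i) = comb (\<lambda>i. a (?b i))"
      unfolding comb_def by (rule sum.mono_neutral_left) auto
    finally show ?thesis .
  qed
  show "module_basis base_ring (GM n) ?B"
    unfolding module_basis_def
  proof (intro conjI ballI)
    show "?B \<subseteq> carrier (GM n)"
      by (auto simp: GM_carrier)
    fix x assume "x \<in> carrier (GM n)"
    then obtain v where v: "\<And>i. i < n \<Longrightarrow> v i \<in> base" "x = cls (comb v)"
      by (rule GM_surj) blast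
    show "\<exists>!a. a \<in> ?B \<rightarrow>\<^sub>E base \<and> finite {y \<in> ?B. a y \<noteq> \<zero>\<^bsub>base_ring\<^esub>} \<and>
        x = (\<Oplus>\<^bsub>GM n\<^esub>y\<in>{y \<in> ?B. a y \<noteq> \<zero>\<^bsub>base_ring\<^esub>}. a y \<odot>\<^bsub>GM n\<^esub> y)"
    proof (rule ex1I)
      let ?a = "restrict (v \<circ> inv_into {..<n} ?b) ?B"
      have a: "?a (?b i) = v i" if "i < n" for i
        using that inv_into_f_f [OF inj, of i] by simp
      then have "?a \<in> ?B \<rightarrow>\<^sub>E base"
        using v(1) by auto
      moreover have "comb (\<lambda>i. ?a (?b i)) = comb v"
        unfolding comb_def by (rule sum.cong) (use a in auto)
      ultimately show "?a \<in> ?B \<rightarrow>\<^sub>E base \<and> finite {y \<in> ?B. ?a y \<noteq> \<zero>\<^bsub>base_ring\<^esub>} \<and>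
        x = (\<Oplus>\<^bsub>GM n\<^esub>y\<in>{y \<in> ?B. ?a y \<noteq> \<zero>\<^bsub>base_ring\<^esub>}. ?a y \<odot>\<^bsub>GM n\<^esub> y)"
        using expand [of ?a] v(2) by simp
      fix a' assume a': "a' \<in> ?B \<rightarrow>\<^sub>E base \<and> finite {y \<in> ?B. a' y \<noteq> \<zero>\<^bsub>base_ring\<^esub>} \<and>
        x = (\<Oplus>\<^bsub>GM n\<^esub>y\<in>{y \<in> ?B. a' y \<noteq> \<zero>\<^bsub>base_ring\<^esub>}. a' y \<odot>\<^bsub>GM n\<^esub> y)"
      then have "cls (comb (\<lambda>i. a' (?b i))) = cls (comb v)"
        using expand [of a'] v(2) by simp
      moreover have "a' (?b i) \<in> base" if "i < n" for i
        using a' that by auto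
      ultimately have "a' (?b i) = v i" if "i < n" for i
        using v(1) that by (intro comb_eq_cls [of "\<lambda>i. a' (?b i)" v i])
      with a have eq: "a' y = ?a y" if "y \<in> ?B" for y
        using that by auto
      show "a' = ?a"
        by (rule PiE_ext [OF conjunct1 [OF a'] \<open>?a \<in> ?B \<rightarrow>\<^sub>E base\<close>]) (rule eq)
    qed
  qed
qed

lemma nabla_leibniz:
  "xpow Theta (-2) * theta_op (a * h) = pdiff Theta a * h + a * (xpow Theta (-2) * theta_op h)"
  "- xpow Theta (-1) * B (a * h) = ldiff Q a * h + a * (- xpow Theta (-1) * B h)"
proof -
  have "xpow Theta (-2) * (\<theta> * p) = xpow Theta (-1) * p" for p
    by (simp add: mult.assoc [symmetric] xpow_mult)
  moreover have "theta_op (a * h) = \<theta> * (ldiff Theta a * h) + a * theta_op h"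
    by (simp add: theta_op_def ldiff_mult algebra_simps)
  ultimately show "xpow Theta (-2) * theta_op (a * h) = pdiff Theta a * h + a * (xpow Theta (-2) * theta_op h)"
    by (simp only: distrib_left pdiff_eq_ldiff mult.assoc mult.left_commute [of "xpow Theta (-2)" a])
  have "- xpow Theta (-1) * B (a * h)
      = xpow Theta (-1) * (\<theta> * (ldiff Q a * h)) - xpow Theta (-1) * (a * B h)"
    by (simp add: B_mult right_diff_distrib mult.assoc)
  then show "- xpow Theta (-1) * B (a * h) = ldiff Q a * h + a * (- xpow Theta (-1) * B h)"
    unfolding xpow_cancel by (simp add: mult.left_commute)
qed

lemma is_connection_GM: "is_connection (GM n) (GM_nabla_theta n) (GM_nabla_q n)"
proof -
  have "theta_op (g + h) = theta_op g + theta_op h" for g h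
    by (simp add: theta_op_def algebra_simps)
  moreover have "ldiff Q a = q * pdiff Q a" for a
    by (simp add: ldiff_def)
  ultimately show ?thesis
    unfolding is_connection_def
    by (auto simp: GM_carrier GM_add GM_nabla_theta_cls GM_nabla_q_cls GM_smult B_add nabla_leibniz
        distrib_left simp del: mult_minus_left)
qed

lemma QD_carrier: "v \<in> carrier (QD n) \<longleftrightarrow> (\<forall>i<n. v i \<in> base) \<and> (\<forall>i\<ge>n. v i = 0)"
  by (simp add: QD_def)

lemma is_module_iso_comb: "is_module_iso base_ring (QD n) (GM n) (\<lambda>v. cls (comb v))"
  unfolding is_module_iso_def
proof (intro conjI ballI)
  show "bij_betw (\<lambda>v. cls (comb v)) (carrier (QD n)) (carrier (GM n))"
  proof (rule bij_betwI')
    fix v w assume "v \<in> carrier (QD n)" "w \<in> carrier (QD n)"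
    moreover from this have "v i = w i" if "cls (comb v) = cls (comb w)" for i
      using comb_eq_cls [of v w i] that by (cases "i < n") (auto simp: QD_carrier)
    ultimately show "cls (comb v) = cls (comb w) \<longleftrightarrow> v = w"
      by auto
  next
    fix v assume "v \<in> carrier (QD n)"
    then show "cls (comb v) \<in> carrier (GM n)"
      by (auto simp: QD_carrier GM_carrier)
  next
    fix x assume "x \<in> carrier (GM n)"
    then obtain v where v: "\<And>i. i < n \<Longrightarrow> v i \<in> base" "x = cls (comb v)"
      by (rule GM_surj) blast
    have "comb (\<lambda>i. if i < n then v i else 0) = comb v"
      unfolding comb_def by (rule sum.cong) auto
    then show "\<exists>v\<in>carrier (QD n). x = cls (comb v)"
      using v by (intro bexI [of _ "\<lambda>i. if i < n then v i else 0"]) (auto simp: QD_carrier)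
  qed
qed (auto simp: QD_def comb_def GM_add GM_smult sum.distrib sum_distrib_left algebra_simps)

text \<open>Both connections satisfy the Leibniz rule, so it suffices to compare them on the basis.\<close>

lemma comb_bmult:
  "comb (\<lambda>j. \<Sum>i<n. x i * bvec i j + y i * bmult n i j)
    = comb x + (\<Sum>i<n. y i * (\<Sum>j<n. bmult n i j * beta j))"
proof -
  have "comb (\<lambda>j. \<Sum>i<n. x i * bvec i j + y i * bmult n i j)
      = (\<Sum>i<n. \<Sum>j<n. (x i * bvec i j + y i * bmult n i j) * beta j)"
    unfolding comb_def sum_distrib_right by (rule sum.swap)
  also have "\<dots> = (\<Sum>i<n. x i * (\<Sum>j<n. bvec i j * beta j) + y i * (\<Sum>j<n. bmult n i j * beta j))"
    by (simp add: sum.distrib sum_distrib_left distrib_right mult.assoc)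
  also have "\<dots> = comb x + (\<Sum>i<n. y i * (\<Sum>j<n. bmult n i j * beta j))"
    by (simp add: comb_def sum.distrib bvec_sum)
  finally show ?thesis .
qed

lemma nabla_q_comb:
  assumes "v \<in> carrier (QD n)"
  shows "cls (comb (QD_nabla_q n v)) = GM_nabla_q n (cls (comb v))"
proof -
  have v: "v i \<in> base" if "i < n" for i
    using assms that by (simp add: QD_carrier)
  have "QD_nabla_q n v = (\<lambda>j. \<Sum>i<n. ldiff Q (v i) * bvec i j + (- xpow Theta (-1) * v i) * bmult n i j)"
    by (simp add: QD_nabla_q_def ldiff_def algebra_simps)
  then have "comb (QD_nabla_q n v)
      = comb (\<lambda>i. ldiff Q (v i)) + (\<Sum>i<n. (- xpow Theta (-1) * v i) * (\<Sum>j<n. bmult n i j * beta j))"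
    by (simp only: comb_bmult)
  moreover have "- xpow Theta (-1) * B (comb v)
      = comb (\<lambda>i. ldiff Q (v i)) + (\<Sum>i<n. (- xpow Theta (-1) * v i) * B (beta i))"
    by (simp add: comb_def B_sum sum_distrib_left nabla_leibniz(2) sum.distrib mult.left_commute
        del: mult_minus_left) (simp add: mult.assoc mult.left_commute)
  ultimately have "comb (QD_nabla_q n v) - - xpow Theta (-1) * B (comb v)
      = (\<Sum>i<n. (xpow Theta (-1) * v i) * (B (beta i) - (\<Sum>j<n. bmult n i j * beta j)))"
    by (simp add: right_diff_distrib sum_subtractf sum_negf)
  also have "\<dots> \<in> Rel"
    using v by (intro Rel_sum Rel_base_mult B_beta) auto
  finally show ?thesis
    by (simp only: GM_nabla_q_cls cls_cong)
qed

lemma nabla_theta_comb: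
  assumes "v \<in> carrier (QD n)"
  shows "cls (comb (QD_nabla_theta n v)) = GM_nabla_theta n (cls (comb v))"
proof -
  let ?m = "of_nat (n - 1) :: laurent" and ?t = "xpow Theta (-2)"
  have v: "v i \<in> base" if "i < n" for i
    using assms that by (simp add: QD_carrier)
  have "QD_nabla_theta n v = (\<lambda>j. \<Sum>i<n. (pdiff Theta (v i) + v i * ?t * of_nat i * \<theta>) * bvec i j
      + (v i * ?t * ?m) * bmult n i j)"
    by (simp add: QD_nabla_theta_def algebra_simps)
  then have "comb (QD_nabla_theta n v) = comb (\<lambda>i. pdiff Theta (v i) + v i * ?t * of_nat i * \<theta>)
      + (\<Sum>i<n. (v i * ?t * ?m) * (\<Sum>j<n. bmult n i j * beta j))"
    by (simp only: comb_bmult)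
  also have "\<dots> = (\<Sum>i<n. pdiff Theta (v i) * beta i
      + v i * ?t * (\<theta> * (of_nat i * beta i) + ?m * (\<Sum>j<n. bmult n i j * beta j)))"
    by (simp add: comb_def sum.distrib [symmetric] algebra_simps)
  finally have QD: "comb (QD_nabla_theta n v) = \<dots>" .
  have "?t * theta_op (comb v) = (\<Sum>i<n. ?t * theta_op (v i * beta i))"
    by (simp add: comb_def theta_op_def ldiff_sum sum_distrib_left sum.distrib [symmetric] distrib_left)
  then have "?t * theta_op (comb v) = (\<Sum>i<n. pdiff Theta (v i) * beta i + v i * ?t * theta_op (beta i))"
    by (simp only: nabla_leibniz(1) mult.assoc)
  then have "comb (QD_nabla_theta n v) - ?t * theta_op (comb v) = - (\<Sum>i<n. v i * ?t *
      ((theta_op (beta i) - (?m * B (beta i) + \<theta> * euler (beta i)))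
        + ?m * (B (beta i) - (\<Sum>j<n. bmult n i j * beta j))))"
    unfolding QD by (simp add: euler_beta sum_subtractf [symmetric] sum_negf [symmetric] algebra_simps)
  also have "\<dots> \<in> Rel"
    using v by (intro Rel_uminus Rel_sum Rel_base_mult Rel_add B_beta theta_op_euler) auto
  finally show ?thesis
    by (simp only: GM_nabla_theta_cls cls_cong)
qed

end

theorem theorem1p0p1:
  fixes n :: nat
  assumes "n \<ge> 3"
  shows "\<exists>H H0.
    internal_direct_sum base_ring (GM n) H H0 \<and>
    free_module_of_rank base_ring (GM n\<lparr>carrier := H\<rparr>) n \<and>
    free_module base_ring (GM n\<lparr>carrier := H0\<rparr>) \<and>
    is_connection (GM n\<lparr>carrier := H\<rparr>) (GM_nabla_theta n) (GM_nabla_q n) \<and>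
    (\<exists>\<phi>. is_module_iso base_ring (QD n) (GM n\<lparr>carrier := H\<rparr>) \<phi> \<and>
      (\<forall>v\<in>carrier (QD n).
         \<phi> (QD_nabla_theta n v) = GM_nabla_theta n (\<phi> v) \<and>
         \<phi> (QD_nabla_q n v) = GM_nabla_q n (\<phi> v)))"
proof -
  interpret quadric n
    by unfold_locales (rule assms)
  interpret module base_ring "GM n"
    by (rule module_GM)
  let ?H = "carrier (GM n)" and ?Z = "{\<zero>\<^bsub>GM n\<^esub>}"
  have H: "GM n\<lparr>carrier := ?H\<rparr> = GM n"
    by simp
  have sub: "submodule ?H base_ring (GM n)" "submodule ?Z base_ring (GM n)"
    by (rule submodule.intro; auto intro!: add.subgroupI submodule_axioms.intro simp: subgroup_def)+
  have "internal_direct_sum base_ring (GM n) ?H ?Z"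
    unfolding internal_direct_sum_def using sub by (force simp: set_add_def')
  moreover have "free_module_of_rank base_ring (GM n) n"
    unfolding free_module_of_rank_def using module_GM module_basis_GM card_basis by blast
  moreover have "free_module base_ring (GM n\<lparr>carrier := ?Z\<rparr>)"
  proof -
    interpret H0: module base_ring "GM n\<lparr>carrier := ?Z\<rparr>"
      by (rule submodule.submodule_is_module [OF sub(2) module_GM])
    have "module_basis base_ring (GM n\<lparr>carrier := ?Z\<rparr>) {}"
      using H0.finsum_empty by (auto simp: module_basis_def)
    then show ?thesis
      unfolding free_module_def using H0.module_axioms by blast
  qed
  moreover have "is_connection (GM n) (GM_nabla_theta n) (GM_nabla_q n)"
    by (rule is_connection_GM)
  moreover have "\<exists>\<phi>. is_module_iso base_ring (QD n) (GM n) \<phi> \<and>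
      (\<forall>v\<in>carrier (QD n).
         \<phi> (QD_nabla_theta n v) = GM_nabla_theta n (\<phi> v) \<and>
         \<phi> (QD_nabla_q n v) = GM_nabla_q n (\<phi> v))"
    using is_module_iso_comb nabla_theta_comb nabla_q_comb by (intro exI [of _ "\<lambda>v. cls (comb v)"]) auto
  ultimately show ?thesis
    by - (rule exI [of _ ?H], rule exI [of _ ?Z], simp only: H)
qed

end
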